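(* Let $A$ be a finite abelian group. The Clifford extension $$1 \longrightarrow V_A \xrightarrow{\ \nu\ } C(A) \xrightarrow{\ \pi\ } \operatorname{Sp}(V_A) \longrightarrow 1$$ splits as a semidirect product (i.e. there is a group homomorphism $\sigma\colon \operatorname{Sp}(V_A)\to C(A)$ with $\pi\circ\sigma=\mathrm{id}$) if and only if $4 \nmid |A|$.
   Context: For a finite abelian group $A$ (written additively), let $\widehat A=\operatorname{Hom}(A,U(1))$ and $V_A=A\oplus\widehat A$ (written additively), with the non-degenerate alternating bicharacter $\omega_A((a,\chi),(b,\psi))=\chi(b)\psi(a)^{-1}\in U(1)$. $\operatorname{Sp}(V_A)$ is the group of automorphisms $T$ of the group $V_A$ with $\omega_A(Tu,Tv)=\omega_A(u,v)$ for all $u,v\in V_A$. On the Hilbert space $\mathcal H=\mathbb C[A]$ with orthonormal basis $\{|a\rangle : a\in A\}$ define the unitary operators $X_a|b\rangle=|a+b\rangle$ and $Z_\chi|b\rangle=\chi(b)|b\rangle$ for $a\in A$, $\chi\in\widehat A$, and the Weyl operators $W_{(a,\chi)}=X_aZ_\chi$. The Heisenberg group is $H(A)=\{zW_u : z\in U(1),\ u\in V_A\}\subset U(\mathcal H)$. The (projective) Clifford group is $C(A)=N_{U(\mathcal H)}(H(A))/(U(1)\cdot I)$, where $N_{U(\mathcal H)}$ denotes the normalizer in the unitary group. For $[U]\in C(A)$ there are a unique $T\in\operatorname{Sp}(V_A)$ and a function $\lambda\colon V_A\to U(1)$ with $UW_uU^\dagger=\lambda(u)W_{Tu}$ for all $u\in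 V_A$; set $\pi([U])=T$. The map $\nu\colon V_A\to C(A)$ is $\nu(v)=[W_v]$. These give the short exact sequence in the claim. *)

theory Defs
  imports "HOL-Analysis.Analysis" "HOL-Algebra.Group_Action"
begin

section \<open>The dual group and the phase space\<close>

text \<open>The finite abelian group \<open>A\<close> is a type \<open>'a :: {ab_group_add, finite}\<close>; \<open>U(1)\<close> is the
  set of complex numbers of norm 1.\<close>

typedef (overloaded) 'a dual =
  "{f :: 'a::ab_group_add \<Rightarrow> complex. (\<forall>a. norm (f a) = 1) \<and> (\<forall>a b. f (a + b) = f a * f b)}"
  morphisms dual_apply Abs_dual
  by (rule exI[of _ "\<lambda>_. 1"]) simp

setup_lifting type_definition_dual

text \<open>Characters are multiplied pointwise; this group is written additively.\<close>

instantiation dual :: (ab_group_add) ab_group_add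
begin
lift_definition zero_dual :: "'a dual" is "\<lambda>_. 1" by simp
lift_definition plus_dual :: "'a dual \<Rightarrow> 'a dual \<Rightarrow> 'a dual" is "\<lambda>f g a. f a * g a"
  by (simp add: norm_mult)
lift_definition uminus_dual :: "'a dual \<Rightarrow> 'a dual" is "\<lambda>f a. inverse (f a)"
  by (simp add: norm_inverse)
lift_definition minus_dual :: "'a dual \<Rightarrow> 'a dual \<Rightarrow> 'a dual" is "\<lambda>f g a. f a * inverse (g a)"
  by (simp add: norm_mult norm_inverse)
instance
proof
  fix x y z :: "'a dual"
  show "x + y + z = x + (y + z)" by transfer (simp add: fun_eq_iff mult.assoc)
  show "x + y = y + x" by transfer (simp add: fun_eq_iff mult.commute)
  show "0 + x = x" by transfer simp
  show "- x + x = 0"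
  proof transfer
    fix f :: "'a \<Rightarrow> complex"
    assume "(\<forall>a. norm (f a) = 1) \<and> (\<forall>a b. f (a + b) = f a * f b)"
    then have "f a \<noteq> 0" for a by (metis norm_zero zero_neq_one)
    then show "(\<lambda>a. inverse (f a) * f a) = (\<lambda>_. 1)" by (simp add: fun_eq_iff)
  qed
  show "x - y = x + - y" by transfer simp
qed
end

text \<open>\<open>V\<^sub>A = A \<oplus> \<hat>A\<close>, with the componentwise addition of the product type.\<close>
type_synonym 'a phase_space = "'a \<times> 'a dual"

definition symp_form :: "'a::ab_group_add phase_space \<Rightarrow> 'a phase_space \<Rightarrow> complex" where
  "symp_form u v = dual_apply (snd u) (fst v) * inverse (dual_apply (snd v) (fst u))"

definition Sp_group :: "('a::ab_group_add phase_space \<Rightarrow> 'a phase_space) monoid" where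
  "Sp_group = \<lparr>carrier = {T. bij T \<and> (\<forall>u v. T (u + v) = T u + T v) \<and>
                            (\<forall>u v. symp_form (T u) (T v) = symp_form u v)},
               mult = (\<circ>), one = id\<rparr>"


section \<open>Weyl operators and the Clifford group\<close>

text \<open>\<open>\<complex>[A]\<close> is \<open>complex ^ 'a\<close>, with \<open>|a\<rangle>\<close> the vector \<open>axis a 1\<close>. Operators are given by their
  matrices in this orthonormal basis, entry \<open>$ i $ j\<close> being \<open>\<langle>i|M|j\<rangle>\<close>.\<close>

type_synonym 'a operator = "complex ^ 'a ^ 'a"

definition adj :: "'a::finite operator \<Rightarrow> 'a operator" where
  "adj M = (\<chi> i j. cnj (M $ j $ i))"

definition unitary_group :: "'a::finite operator monoid" where
  "unitary_group = \<lparr>carrier = {U. U ** adj U = mat 1 \<and> adj U ** U = mat 1},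
                    mult = (**), one = mat 1\<rparr>"

definition X_op :: "'a::{ab_group_add,finite} \<Rightarrow> 'a operator" where
  "X_op a = (\<chi> i j. if i = a + j then 1 else 0)"

definition Z_op :: "'a::{ab_group_add,finite} dual \<Rightarrow> 'a operator" where
  "Z_op c = (\<chi> i j. if i = j then dual_apply c j else 0)"

lemma X_op_basis: "X_op a *v axis b 1 = axis (a + b) 1"
  by (auto simp: X_op_def vec_eq_iff matrix_vector_mult_def axis_def if_distrib[of "\<lambda>x. _ * x"]
        cong: if_cong)

lemma Z_op_basis: "Z_op c *v axis b 1 = dual_apply c b *s axis b 1"
  by (auto simp: Z_op_def vec_eq_iff matrix_vector_mult_def axis_def if_distrib[of "\<lambda>x. _ * x"]
        cong: if_cong)

definition weyl :: "'a::{ab_group_add,finite} phase_space \<Rightarrow> 'a operator" where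
  "weyl u = X_op (fst u) ** Z_op (snd u)"

text \<open>The scalar multiple \<open>z M\<close> of an operator is written \<open>mat z ** M\<close>.\<close>

definition heisenberg :: "'a::{ab_group_add,finite} operator set" where
  "heisenberg = {mat z ** weyl u | z u. norm z = 1}"

definition phases :: "'a::finite operator set" where
  "phases = {mat z | z. norm z = 1}"

definition clifford_unitaries :: "'a::{ab_group_add,finite} operator monoid" where
  "clifford_unitaries = unitary_group \<lparr>carrier := normalizer unitary_group heisenberg\<rparr>"

definition clifford_group :: "'a::{ab_group_add,finite} operator set monoid" where
  "clifford_group = clifford_unitaries Mod phases"

text \<open>The maps \<open>\<nu>\<close> and \<open>\<pi>\<close> of the Clifford extension are \<open>weyl_class\<close> and \<open>clifford_proj\<close>.
  That \<open>T\<close> in the latter exists, is unique and does not depend on the representative is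
  \<open>clifford_proj_class\<close> and \<open>acts_by_unique\<close> below.\<close>

definition weyl_class :: "'a::{ab_group_add,finite} phase_space \<Rightarrow> 'a operator set" where
  "weyl_class v = phases #>\<^bsub>clifford_unitaries\<^esub> weyl v"

definition acts_by ::
  "'a::{ab_group_add,finite} operator \<Rightarrow> ('a phase_space \<Rightarrow> 'a phase_space) \<Rightarrow> bool" where
  "acts_by U T \<longleftrightarrow> (\<exists>l. (\<forall>u. norm (l u) = 1) \<and>
                        (\<forall>u. U ** weyl u ** adj U = mat (l u) ** weyl (T u)))"

definition clifford_proj ::
  "'a::{ab_group_add,finite} operator set \<Rightarrow> 'a phase_space \<Rightarrow> 'a phase_space" where
  "clifford_proj c = (THE T. T \<in> carrier Sp_group \<and> (\<exists>U\<in>c. acts_by U T))"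


section \<open>Well-definedness and basic properties\<close>

lemma dual_apply_norm [simp]: "norm (dual_apply c a) = 1"
  using dual_apply[of c] by simp

lemma dual_apply_add: "dual_apply c (a + b) = dual_apply c a * dual_apply c b"
  using dual_apply[of c] by simp

lemma dual_apply_nz [simp]: "dual_apply c a \<noteq> 0"
  by (metis dual_apply_norm norm_zero zero_neq_one)

lemma dual_apply_0 [simp]: "dual_apply c 0 = 1"
  using dual_apply_add[of c 0 0] by simp

lemma dual_apply_plus [simp]: "dual_apply (c + d) a = dual_apply c a * dual_apply d a"
  by transfer simp

lemma dual_apply_zero [simp]: "dual_apply 0 a = 1"
  by transfer simp

lemma symp_form_nz: "symp_form u v \<noteq> 0"
  by (simp add: symp_form_def)

lemma scal_nth [simp]: "(mat z ** M) $ i $ j = z * (M :: 'a::finite operator) $ i $ j"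
  by (simp add: matrix_matrix_mult_def mat_def if_distrib[of "\<lambda>x. x * _"] cong: if_cong)

lemma scal_nth_right [simp]: "(M ** mat z) $ i $ j = z * (M :: 'a::finite operator) $ i $ j"
  by (simp add: matrix_matrix_mult_def mat_def if_distrib[of "\<lambda>x. _ * x"] mult.commute cong: if_cong)

lemma scal_commute: "M ** mat z = mat z ** (M :: 'a::finite operator)"
  by (simp add: vec_eq_iff)

lemma mat_mult: "mat z ** mat w = (mat (z * w) :: 'a::finite operator)"
  by (simp add: vec_eq_iff) (simp add: mat_def)

lemma scal_left: "(mat z ** M) ** N = mat z ** (M ** (N :: 'a::finite operator))"
  by (simp only: matrix_mul_assoc)

lemma scal_scal: "mat z ** (mat w ** M) = mat (z * w) ** (M :: 'a::finite operator)"
  by (simp only: matrix_mul_assoc mat_mult)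

lemma scal_right:
  fixes M N :: "'a::finite operator"
  shows "M ** (mat z ** N) = mat z ** (M ** N)"
  by (simp only: matrix_mul_assoc scal_commute[of M])

lemma scal_prod:
  fixes M N :: "'a::finite operator"
  shows "(mat z ** M) ** (mat w ** N) = mat (z * w) ** (M ** N)"
proof -
  have "(mat z ** M) ** (mat w ** N) = mat z ** (mat w ** (M ** N))"
    by (simp only: scal_left scal_right[of M])
  then show ?thesis by (simp only: scal_scal)
qed

lemma adj_adj [simp]: "adj (adj M) = M"
  by (simp add: adj_def vec_eq_iff)

lemma adj_mult: "adj (M ** N) = adj N ** adj M"
  by (simp add: adj_def matrix_matrix_mult_def vec_eq_iff mult.commute)

lemma adj_mat [simp]: "adj (mat z) = mat (cnj z)"
  by (auto simp: adj_def mat_def vec_eq_iff)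

lemma conj_scal:
  "(mat z ** U) ** M ** adj (mat z ** U) = mat (z * cnj z) ** (U ** M ** adj (U :: 'a::finite operator))"
proof -
  have "(mat z ** U) ** M ** adj (mat z ** U) = (mat z ** (U ** M ** adj U)) ** mat (cnj z)"
    by (simp only: adj_mult adj_mat matrix_mul_assoc)
  then show ?thesis by (simp only: scal_commute scal_scal mult.commute)
qed

lemma unit_cnj: "norm (z::complex) = 1 \<Longrightarrow> z * cnj z = 1" "norm (z::complex) = 1 \<Longrightarrow> cnj z * z = 1"
  by (simp_all add: complex_norm_square[symmetric] mult.commute[of "cnj z"])

lemma weyl_nth: "weyl u $ i $ j = (if i = fst u + j then dual_apply (snd u) j else 0)"
  by (simp add: weyl_def X_op_def Z_op_def matrix_matrix_mult_def if_distrib[of "\<lambda>x. _ * x"] cong: if_cong)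

lemma weyl_mult: "weyl u ** weyl v = mat (dual_apply (snd u) (fst v)) ** weyl (u + v)"
proof -
  have "(weyl u ** weyl v) $ i $ j = (mat (dual_apply (snd u) (fst v)) ** weyl (u + v)) $ i $ j" for i j
    by (auto simp: matrix_matrix_mult_def[of "weyl u"] weyl_nth dual_apply_add add.assoc
        if_distrib[of "\<lambda>x. _ * x"] cong: if_cong)
  then show ?thesis by (simp add: vec_eq_iff)
qed

lemma weyl_0: "weyl 0 = mat 1"
  by (auto simp: vec_eq_iff weyl_nth mat_def)

lemma weyl_commutation: "weyl u ** weyl v = mat (symp_form u v) ** (weyl v ** weyl u)"
  by (simp add: weyl_mult scal_scal symp_form_def add.commute mult.assoc)

lemma weyl_unitary: "weyl u ** adj (weyl u) = mat 1" "adj (weyl u) ** weyl u = mat 1"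
proof -
  show 1: "adj (weyl u) ** weyl u = mat 1"
    by (auto simp: vec_eq_iff matrix_matrix_mult_def weyl_nth adj_def mat_def unit_cnj
        if_distrib[of "\<lambda>x. _ * x"] if_distrib[of cnj] cong: if_cong)
  then show "weyl u ** adj (weyl u) = mat 1"
    by (simp add: matrix_left_right_inverse)
qed

lemma weyl_proportional:
  assumes "mat z ** weyl u = mat w ** weyl v" "z \<noteq> 0"
  shows "u = v \<and> z = w"
proof -
  have e: "z * weyl u $ i $ j = w * weyl v $ i $ j" for i j
    using assms(1) by (metis scal_nth)
  have f: "fst u = fst v" and zw: "z = w"
    using e[of "fst u" 0] assms(2) by (auto simp: weyl_nth split: if_splits)
  have "dual_apply (snd u) j = dual_apply (snd v) j" for j
    using e[of "fst u + j" j] f zw assms(2) by (auto simp: weyl_nth)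
  then have "snd u = snd v" by (metis dual_apply_inject ext)
  with f zw show ?thesis by (simp add: prod_eq_iff)
qed

lemma unitary_group_simps [simp]:
  "x \<otimes>\<^bsub>unitary_group\<^esub> y = x ** y" "\<one>\<^bsub>unitary_group\<^esub> = mat 1"
  by (simp_all add: unitary_group_def)

lemma unitary_carrier: "U \<in> carrier unitary_group \<longleftrightarrow> U ** adj U = mat 1 \<and> adj U ** U = mat 1"
  by (simp add: unitary_group_def)

lemma unitary_group_group: "group (unitary_group :: 'a::finite operator monoid)"
proof (rule groupI)
  fix x y :: "'a operator"
  assume "x \<in> carrier unitary_group" "y \<in> carrier unitary_group"
  then have x: "x ** adj x = mat 1" "adj x ** x = mat 1" and y: "y ** adj y = mat 1" "adj y ** y = mat 1"
    by (auto simp: unitary_carrier)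
  have "(x ** y) ** adj (x ** y) = x ** (y ** adj y) ** adj x"
    by (simp only: adj_mult matrix_mul_assoc)
  moreover have "adj (x ** y) ** (x ** y) = adj y ** (adj x ** x) ** y"
    by (simp only: adj_mult matrix_mul_assoc)
  ultimately show "x \<otimes>\<^bsub>unitary_group\<^esub> y \<in> carrier unitary_group"
    using x y by (simp add: unitary_carrier)
next
  fix x :: "'a operator" assume "x \<in> carrier unitary_group"
  then show "\<exists>y\<in>carrier unitary_group. y \<otimes>\<^bsub>unitary_group\<^esub> x = \<one>\<^bsub>unitary_group\<^esub>"
    by (intro bexI[of _ "adj x"]) (auto simp: unitary_carrier)
qed (auto simp: unitary_carrier matrix_mul_assoc)

lemma unitary_inv: "U \<in> carrier unitary_group \<Longrightarrow> inv\<^bsub>unitary_group\<^esub> U = adj U"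
  by (rule group.inv_equality[OF unitary_group_group]) (auto simp: unitary_carrier)

lemma heisenberg_subset: "heisenberg \<subseteq> carrier unitary_group"
proof
  fix x :: "'a operator" assume "x \<in> heisenberg"
  then obtain z u where x: "x = mat z ** weyl u" "norm z = 1" by (auto simp: heisenberg_def)
  have 1: "x ** adj x = mat 1"
    using conj_scal[of z "weyl u" "mat 1"] x by (simp add: weyl_unitary unit_cnj)
  then show "x \<in> carrier unitary_group"
    by (simp add: unitary_carrier matrix_left_right_inverse)
qed

lemma normalizer_heisenberg:
  "U \<in> normalizer unitary_group heisenberg \<longleftrightarrow>
     U \<in> carrier unitary_group \<and> (\<lambda>M. U ** M ** adj U) ` heisenberg = heisenberg"
proof -
  have "U <#\<^bsub>unitary_group\<^esub> heisenberg #>\<^bsub>unitary_group\<^esub> adj U = (\<lambda>M. U ** M ** adj U) ` heisenberg"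
    by (simp add: l_coset_def r_coset_def UNION_singleton_eq_range image_image)
  then show ?thesis
    unfolding normalizer_def stabilizer_def
    by (simp add: unitary_inv heisenberg_subset cong: conj_cong)
qed

lemma phases_subset: "phases \<subseteq> normalizer unitary_group heisenberg"
proof
  fix x :: "'a operator" assume "x \<in> phases"
  then obtain z where x: "x = mat z" "norm z = 1" by (auto simp: phases_def)
  have "x \<in> carrier unitary_group" using x by (simp add: unitary_carrier mat_mult unit_cnj)
  moreover have "x ** M ** adj x = M" for M
    using conj_scal[of z "mat 1" M] x by (simp add: unit_cnj)
  ultimately show "x \<in> normalizer unitary_group heisenberg"
    by (simp add: normalizer_heisenberg)
qed

lemma clifford_unitaries_group: "group clifford_unitaries"
  unfolding clifford_unitaries_def
  by (intro group.subgroup_imp_group unitary_group_group group.normalizer_imp_subgroup heisenberg_subset)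

lemma clifford_unitaries_simps [simp]:
  "x \<otimes>\<^bsub>clifford_unitaries\<^esub> y = x ** y" "\<one>\<^bsub>clifford_unitaries\<^esub> = mat 1"
  "carrier clifford_unitaries = normalizer unitary_group heisenberg"
  by (simp_all add: clifford_unitaries_def)

lemma phases_normal: "phases \<lhd> (clifford_unitaries :: 'a::{ab_group_add,finite} operator monoid)"
proof -
  interpret C: group "clifford_unitaries :: 'a operator monoid" by (rule clifford_unitaries_group)
  have inv: "inv\<^bsub>clifford_unitaries\<^esub> mat z = (mat (cnj z) :: 'a operator)" if "norm z = 1" for z
  proof (rule C.inv_equality)
    have "mat w \<in> carrier (clifford_unitaries :: 'a operator monoid)" if "norm w = 1" for w
      using that phases_subset[where 'a='a] by (auto simp: phases_def)
    from this[of z] this[of "cnj z"] that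
    show "mat z \<in> carrier (clifford_unitaries :: 'a operator monoid)"
      "mat (cnj z) \<in> carrier (clifford_unitaries :: 'a operator monoid)" by auto
  qed (use that in \<open>simp add: mat_mult unit_cnj\<close>)
  have "subgroup phases (clifford_unitaries :: 'a operator monoid)"
  proof (rule C.subgroupI)
    show "(phases :: 'a operator set) \<noteq> {}" using norm_one[where 'a=complex] unfolding phases_def by blast
  next
    fix a :: "'a operator" assume "a \<in> phases"
    then show "inv\<^bsub>clifford_unitaries\<^esub> a \<in> phases" by (auto simp: phases_def inv)
  next
    fix a b :: "'a operator" assume "a \<in> phases" "b \<in> phases"
    then obtain z w where "a = mat z" "b = mat w" "norm z = 1" "norm w = 1"
      by (auto simp: phases_def)
    then have "a ** b = mat (z * w) \<and> norm (z * w) = 1" by (simp only: mat_mult norm_mult) simp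
    then show "a \<otimes>\<^bsub>clifford_unitaries\<^esub> b \<in> phases"
      unfolding phases_def clifford_unitaries_simps by blast
  qed (use phases_subset in auto)
  moreover have "x \<otimes>\<^bsub>clifford_unitaries\<^esub> h \<otimes>\<^bsub>clifford_unitaries\<^esub> inv\<^bsub>clifford_unitaries\<^esub> x \<in> phases"
    if xh: "x \<in> carrier clifford_unitaries" "h \<in> phases" for x h :: "'a operator"
  proof -
    obtain z where z: "h = mat z" using xh(2) by (auto simp: phases_def)
    have "x ** h ** inv\<^bsub>clifford_unitaries\<^esub> x = h ** (x ** inv\<^bsub>clifford_unitaries\<^esub> x)"
      unfolding z scal_commute[of x] by (simp only: matrix_mul_assoc)
    also have "x ** inv\<^bsub>clifford_unitaries\<^esub> x = mat 1"
      using C.r_inv[OF that(1)] by simp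
    finally show ?thesis using that(2) by simp
  qed
  ultimately show ?thesis by (simp add: C.normal_inv_iff)
qed

lemma clifford_group_group: "group clifford_group"
  unfolding clifford_group_def by (rule normal.factorgroup_is_group[OF phases_normal])

lemma Sp_group_group: "group (Sp_group :: ('a::ab_group_add phase_space \<Rightarrow> _) monoid)"
proof (rule groupI)
  fix T :: "'a phase_space \<Rightarrow> 'a phase_space" assume "T \<in> carrier Sp_group"
  then have T: "bij T" "\<And>u v. T (u + v) = T u + T v" "\<And>u v. symp_form (T u) (T v) = symp_form u v"
    by (auto simp: Sp_group_def)
  have s: "T (inv_into UNIV T u) = u" for u using T(1) by (simp add: bij_is_surj surj_f_inv_f)
  have "inv_into UNIV T (u + v) = inv_into UNIV T u + inv_into UNIV T v" for u v
  proof -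
    have "T (inv_into UNIV T (u + v)) = T (inv_into UNIV T u + inv_into UNIV T v)"
      by (simp only: T(2) s)
    then show ?thesis using T(1) by (meson bij_is_inj injD)
  qed
  moreover have "symp_form (inv_into UNIV T u) (inv_into UNIV T v) = symp_form u v" for u v
    using T(3)[of "inv_into UNIV T u" "inv_into UNIV T v"] by (simp only: s)
  ultimately show "\<exists>y\<in>carrier Sp_group. y \<otimes>\<^bsub>Sp_group\<^esub> T = \<one>\<^bsub>Sp_group\<^esub>"
    using T(1) by (intro bexI[of _ "inv_into UNIV T"])
      (simp_all add: Sp_group_def bij_imp_bij_inv bij_is_inj del: split_paired_All)
qed (auto simp: Sp_group_def bij_comp comp_assoc simp del: split_paired_All)

lemma acts_byI:
  assumes "\<And>u. norm (l u) = 1" "\<And>u. U ** weyl u ** adj U = mat (l u) ** weyl (T u)"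
  shows "acts_by U T"
  using assms unfolding acts_by_def by blast

lemma acts_by_unique:
  assumes "acts_by U T" "acts_by U T'"
  shows "T = T'"
proof
  fix u
  obtain l l' where "mat (l u) ** weyl (T u) = mat (l' u) ** weyl (T' u)" "norm (l u) = 1"
  proof -
    from assms obtain l l' where "\<And>u. norm (l u) = 1"
      "\<And>u. U ** weyl u ** adj U = mat (l u) ** weyl (T u)"
      "\<And>u. U ** weyl u ** adj U = mat (l' u) ** weyl (T' u)"
      unfolding acts_by_def by blast
    with that[of l l'] show ?thesis by simp
  qed
  from weyl_proportional[OF this(1)] this(2) show "T u = T' u" by fastforce
qed

lemma acts_by_phase:
  assumes "norm z = 1" shows "acts_by (mat z ** U) T \<longleftrightarrow> acts_by U T"
  using assms
  by (simp add: acts_by_def conj_scal unit_cnj)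

lemma acts_by_exists:
  fixes U :: "'a::{ab_group_add,finite} operator"
  assumes "U \<in> normalizer unitary_group heisenberg"
  shows "\<exists>T\<in>carrier Sp_group. acts_by U T"
proof -
  define c where "c M = U ** M ** adj U" for M
  have U: "U ** adj U = mat 1" "adj U ** U = mat 1" and img: "c ` heisenberg = heisenberg"
    using assms by (auto simp: normalizer_heisenberg unitary_carrier c_def[abs_def])
  have cm: "c (M ** N) = c M ** c N" for M N
  proof -
    have "c M ** c N = U ** M ** (adj U ** U) ** N ** adj U"
      by (simp only: c_def matrix_mul_assoc)
    then show ?thesis by (simp add: U c_def matrix_mul_assoc)
  qed
  have cs: "c (mat z ** M) = mat z ** c M" for z M
    by (simp only: c_def scal_right[of U] scal_left)
  have ci: "M = N" if "c M = c N" for M N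
  proof -
    have "adj U ** c M ** U = (adj U ** U) ** M ** (adj U ** U)" for M
      by (simp only: c_def matrix_mul_assoc)
    then show ?thesis using that by (metis U(2) matrix_mul_lid matrix_mul_rid)
  qed
  have weyl_heis: "weyl u \<in> heisenberg" for u :: "'a phase_space"
  proof -
    have "weyl u = mat 1 ** weyl u \<and> norm (1::complex) = 1" by simp
    then show ?thesis unfolding heisenberg_def by blast
  qed
  have "\<exists>z v. norm z = 1 \<and> c (weyl u) = mat z ** weyl v" for u
  proof -
    have "c (weyl u) \<in> heisenberg" using weyl_heis[of u] img by blast
    then show ?thesis unfolding heisenberg_def by blast
  qed
  then obtain l T where lT: "\<And>u. norm (l u) = 1" "\<And>u. c (weyl u) = mat (l u) ** weyl (T u)"
    by metis
  have lnz: "l u \<noteq> 0" for u using lT(1) by (metis norm_zero zero_neq_one)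
  have "T (u + v) = T u + T v" for u v
  proof -
    have "c (weyl u ** weyl v) = mat (dual_apply (snd u) (fst v) * l (u + v)) ** weyl (T (u + v))"
      by (simp only: weyl_mult cs lT scal_scal)
    moreover have "c (weyl u ** weyl v) =
        mat (l u * l v * dual_apply (snd (T u)) (fst (T v))) ** weyl (T u + T v)"
      unfolding cm lT scal_prod by (simp only: weyl_mult scal_scal)
    ultimately show ?thesis using weyl_proportional lnz by (metis dual_apply_nz mult_eq_0_iff)
  qed
  moreover have "symp_form (T u) (T v) = symp_form u v" for u v
  proof -
    have "c (weyl u ** weyl v) =
        mat (l u * l v * symp_form (T u) (T v)) ** (weyl (T v) ** weyl (T u))"
      unfolding cm lT scal_prod by (subst weyl_commutation) (rule scal_scal)
    moreover have "c (weyl u ** weyl v) =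
        mat (symp_form u v * (l v * l u)) ** (weyl (T v) ** weyl (T u))"
      by (subst weyl_commutation) (simp only: cs, simp only: cm lT scal_prod, rule scal_scal)
    ultimately have "mat (l u * l v * symp_form (T u) (T v) * dual_apply (snd (T v)) (fst (T u)))
          ** weyl (T v + T u)
        = mat (symp_form u v * (l v * l u) * dual_apply (snd (T v)) (fst (T u))) ** weyl (T v + T u)"
      by (simp only: weyl_mult scal_scal)
    from weyl_proportional[OF this] lnz symp_form_nz[of "T u" "T v"] show ?thesis
      by (simp add: mult.commute mult.left_commute)
  qed
  moreover have "inj T"
  proof (rule injI)
    fix u v assume "T u = T v"
    then have "c (mat (l v) ** weyl u) = c (mat (l u) ** weyl v)"
      by (simp only: cs lT scal_scal mult.commute)
    then show "u = v" using ci weyl_proportional lnz by blast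
  qed
  moreover have "surj T"
  proof -
    have "\<exists>u. T u = v" for v
    proof -
      have "weyl v \<in> c ` heisenberg" unfolding img by (rule weyl_heis)
      then obtain z u where "weyl v = c (mat z ** weyl u)" by (auto simp: heisenberg_def)
      then have "weyl v = mat (z * l u) ** weyl (T u)" by (simp only: cs lT scal_scal)
      then have "mat 1 ** weyl v = mat (z * l u) ** weyl (T u)" by (simp only: matrix_mul_lid)
      from weyl_proportional[OF this] show ?thesis by (metis zero_neq_one)
    qed
    then show ?thesis by (metis surjI)
  qed
  moreover have "acts_by U T" using lT unfolding acts_by_def c_def by blast
  ultimately show ?thesis by (auto simp: Sp_group_def bij_def)
qed

lemma coset_phases: "phases #>\<^bsub>clifford_unitaries\<^esub> U = {mat z ** U | z. norm z = 1}"
  by (auto simp: r_coset_def phases_def)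

lemma clifford_proj_class:
  assumes "U \<in> normalizer unitary_group heisenberg"
  shows "clifford_proj (phases #>\<^bsub>clifford_unitaries\<^esub> U) \<in> carrier Sp_group"
    and "acts_by U (clifford_proj (phases #>\<^bsub>clifford_unitaries\<^esub> U))"
proof -
  obtain T where T: "T \<in> carrier Sp_group" "acts_by U T" using acts_by_exists[OF assms] by blast
  have iff: "(\<exists>V\<in>phases #>\<^bsub>clifford_unitaries\<^esub> U. acts_by V S) \<longleftrightarrow> acts_by U S" for S
    unfolding coset_phases using acts_by_phase norm_one by blast
  have "clifford_proj (phases #>\<^bsub>clifford_unitaries\<^esub> U) = T"
    unfolding clifford_proj_def iff using T acts_by_unique by blast
  with T show "clifford_proj (phases #>\<^bsub>clifford_unitaries\<^esub> U) \<in> carrier Sp_group"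
    "acts_by U (clifford_proj (phases #>\<^bsub>clifford_unitaries\<^esub> U))" by auto
qed

lemma clifford_proj_eqI:
  assumes "U \<in> normalizer unitary_group heisenberg" "acts_by U T"
  shows "clifford_proj (phases #>\<^bsub>clifford_unitaries\<^esub> U) = T"
  using clifford_proj_class(2)[OF assms(1)] assms(2) by (rule acts_by_unique)

lemma clifford_proj_hom: "clifford_proj \<in> hom clifford_group Sp_group"
proof (rule homI)
  fix x :: "'a operator set" assume "x \<in> carrier clifford_group"
  then show "clifford_proj x \<in> carrier Sp_group"
    by (auto simp: clifford_group_def carrier_FactGroup clifford_proj_class)
next
  fix x y :: "'a operator set"
  assume "x \<in> carrier clifford_group" "y \<in> carrier clifford_group"
  then obtain U V where U: "U \<in> carrier clifford_unitaries" "x = phases #>\<^bsub>clifford_unitaries\<^esub> U"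
    and V: "V \<in> carrier clifford_unitaries" "y = phases #>\<^bsub>clifford_unitaries\<^esub> V"
    by (auto simp: clifford_group_def carrier_FactGroup)
  let ?S = "clifford_proj x" and ?T = "clifford_proj y"
  have "acts_by U ?S" "acts_by V ?T" using U V clifford_proj_class(2) by auto
  then obtain k l where k: "\<And>u. norm (k u) = 1" "\<And>u. U ** weyl u ** adj U = mat (k u) ** weyl (?S u)"
    and l: "\<And>u. norm (l u) = 1" "\<And>u. V ** weyl u ** adj V = mat (l u) ** weyl (?T u)"
    unfolding acts_by_def by blast
  have "(U ** V) ** weyl u ** adj (U ** V) = mat (l u * k (?T u)) ** weyl (?S (?T u))" for u
  proof -
    have "(U ** V) ** weyl u ** adj (U ** V) = U ** (V ** weyl u ** adj V) ** adj U"
      by (simp only: adj_mult matrix_mul_assoc)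
    also have "\<dots> = mat (l u) ** (U ** weyl (?T u) ** adj U)"
      by (simp only: l(2) scal_right[of U] scal_left)
    finally show ?thesis by (simp only: k(2) scal_scal)
  qed
  moreover have "norm (l u * k (?T u)) = 1" for u using k(1) l(1) by (simp add: norm_mult)
  ultimately have "acts_by (U ** V) (?S \<circ> ?T)"
    by (intro acts_byI[where l="\<lambda>u. l u * k (?T u)"]) (simp_all only: comp_apply)
  moreover have "U ** V \<in> normalizer unitary_group heisenberg"
    using group.subgroup_self[OF clifford_unitaries_group[where 'a='a]] U(1) V(1)
      subgroup.m_closed[of "carrier clifford_unitaries" clifford_unitaries U V] by simp
  moreover have "x \<otimes>\<^bsub>clifford_group\<^esub> y = phases #>\<^bsub>clifford_unitaries\<^esub> (U ** V)"
    using normal.rcos_sum[OF phases_normal U(1) V(1)] U(2) V(2) by (simp add: clifford_group_def)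
  ultimately show "clifford_proj (x \<otimes>\<^bsub>clifford_group\<^esub> y) = ?S \<otimes>\<^bsub>Sp_group\<^esub> ?T"
    by (simp add: clifford_proj_eqI Sp_group_def)
qed

lemma symp_form_norm: "norm (symp_form u v) = 1"
  by (simp add: symp_form_def norm_mult norm_inverse)

lemma weyl_conj: "weyl v ** weyl u ** adj (weyl v) = mat (symp_form v u) ** weyl u"
proof -
  have "weyl v ** weyl u ** adj (weyl v) = mat (symp_form v u) ** (weyl u ** (weyl v ** adj (weyl v)))"
    by (subst weyl_commutation) (simp only: matrix_mul_assoc)
  then show ?thesis by (simp add: weyl_unitary)
qed

lemma weyl_normalizes:
  fixes v :: "'a::{ab_group_add,finite} phase_space"
  shows "weyl v \<in> normalizer unitary_group heisenberg"
proof -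
  define c where "c M = weyl v ** M ** adj (weyl v)" for M
  have c: "c (mat z ** weyl u) = mat (z * symp_form v u) ** weyl u" for z u
    by (simp only: c_def scal_right[of "weyl v"] scal_left weyl_conj scal_scal)
  have "c ` heisenberg \<subseteq> heisenberg"
  proof
    fix M assume "M \<in> c ` heisenberg"
    then obtain z u where "M = c (mat z ** weyl u)" and z: "norm z = 1" by (auto simp: heisenberg_def)
    then have "M = mat (z * symp_form v u) ** weyl u" by (simp only: c)
    moreover have "norm (z * symp_form v u) = 1" using z by (simp add: norm_mult symp_form_norm)
    ultimately show "M \<in> heisenberg" unfolding heisenberg_def by blast
  qed
  moreover have "heisenberg \<subseteq> c ` heisenberg"
  proof
    fix M :: "'a operator" assume "M \<in> heisenberg"
    then obtain z u where M: "M = mat z ** weyl u" and z: "norm z = 1" by (auto simp: heisenberg_def)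
    let ?w = "z / symp_form v u"
    have "M = c (mat ?w ** weyl u)" unfolding c M by (simp add: symp_form_nz)
    moreover have "norm ?w = 1" using z by (simp add: norm_divide symp_form_norm)
    then have "mat ?w ** weyl u \<in> heisenberg" unfolding heisenberg_def by blast
    ultimately show "M \<in> c ` heisenberg" by (rule image_eqI)
  qed
  ultimately show ?thesis
    using weyl_unitary[of v] unfolding normalizer_heisenberg unitary_carrier c_def[abs_def] by blast
qed

lemma weyl_class_mult: "weyl_class (u + v) = weyl_class u \<otimes>\<^bsub>clifford_group\<^esub> weyl_class v"
proof -
  have "weyl_class u \<otimes>\<^bsub>clifford_group\<^esub> weyl_class v = phases #>\<^bsub>clifford_unitaries\<^esub> (weyl u ** weyl v)"
    using normal.rcos_sum[OF phases_normal, of "weyl u" "weyl v"]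
    by (simp add: weyl_class_def clifford_group_def weyl_normalizes)
  also have "\<dots> = phases #>\<^bsub>clifford_unitaries\<^esub> weyl (u + v)"
  proof -
    let ?s = "dual_apply (snd u) (fst v)"
    have "{mat z ** (mat ?s ** weyl (u + v)) |z. norm z = 1} = {mat z ** weyl (u + v) |z. norm z = 1}"
    proof (intro equalityI subsetI)
      fix M assume "M \<in> {mat z ** (mat ?s ** weyl (u + v)) |z. norm z = 1}"
      then obtain z where "M = mat (z * ?s) ** weyl (u + v)" "norm (z * ?s) = 1"
        by (auto simp: scal_scal norm_mult)
      then show "M \<in> {mat z ** weyl (u + v) |z. norm z = 1}" by blast
    next
      fix M assume "M \<in> {mat z ** weyl (u + v) |z. norm z = 1}"
      then obtain z where z: "M = mat z ** weyl (u + v)" "norm z = 1" by auto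
      then have "M = mat (z / ?s) ** (mat ?s ** weyl (u + v))" "norm (z / ?s) = 1"
        by (simp_all add: scal_scal norm_divide)
      then show "M \<in> {mat z ** (mat ?s ** weyl (u + v)) |z. norm z = 1}" by blast
    qed
    then show ?thesis by (simp only: weyl_mult coset_phases)
  qed
  finally show ?thesis by (simp add: weyl_class_def)
qed

lemma inj_weyl_class: "inj weyl_class"
proof (rule injI)
  fix u v :: "'a phase_space" assume eq: "weyl_class u = weyl_class v"
  have "mat 1 ** weyl u \<in> weyl_class u"
    unfolding weyl_class_def coset_phases using norm_one[where 'a=complex] by blast
  then obtain z where "mat 1 ** weyl u = mat z ** weyl v"
    unfolding eq unfolding weyl_class_def coset_phases by blast
  from weyl_proportional[OF this] show "u = v" by simp
qed

lemma clifford_proj_weyl_class: "clifford_proj (weyl_class v) = \<one>\<^bsub>Sp_group\<^esub>"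
proof -
  have "acts_by (weyl v) id"
    by (intro acts_byI[where l="symp_form v"]) (simp_all only: weyl_conj symp_form_norm id_apply)
  from clifford_proj_eqI[OF weyl_normalizes this] show ?thesis
    by (simp add: weyl_class_def Sp_group_def)
qed

end

theory Submission
  imports Defs
begin

text \<open>Write \<open>c(u,v)\<close> for the cocycle \<open>W\<^sub>u W\<^sub>v = c(u,v) W\<^bsub>u+v\<^esub>\<close>. By Schur's lemma and the
  Stone--von Neumann theorem, a unitary lift of \<open>T\<close> is, up to a phase, the same as a function
  \<open>\<lambda>\<^sub>T\<close> with \<open>\<lambda>\<^sub>T(u) \<lambda>\<^sub>T(v) c(Tu,Tv) = c(u,v) \<lambda>\<^sub>T(u+v)\<close>, so a splitting is a choice of such functions
  with \<open>\<lambda>\<^bsub>ST\<^esub>(u) = \<lambda>\<^sub>S(Tu) \<lambda>\<^sub>T(u)\<close>.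

  If \<open>4\<close> divides \<open>|A|\<close>, take an involution \<open>h\<close> of \<open>A\<close>, the transvection \<open>T\<close> along \<open>(h,0)\<close> and
  \<open>\<lambda> = \<lambda>\<^sub>T\<close>. On the fixed points of \<open>T\<close> the function \<open>\<lambda>\<close> is invariant under every symplectic map
  commuting with \<open>T\<close>, while \<open>\<lambda>(2u) = - \<lambda>(u)\<^sup>2\<close> for the other \<open>u\<close>. If \<open>h\<close> is divisible by \<open>2\<close>, a shear
  forces \<open>\<lambda>(h,0) = -1\<close>, whereas \<open>h = 2k\<close> gives \<open>\<lambda>(h,0) = \<lambda>(k,0)\<^sup>2 = 1\<close>. If \<open>h\<close> is not divisible
  by \<open>2\<close>, there is a second involution, whose transvections force \<open>\<lambda>(h,0) = 1\<close>, whereas a character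
  of order \<open>2\<close> with value \<open>-1\<close> at \<open>h\<close> forces \<open>\<lambda>(h,0) = -1\<close>.

  If \<open>4\<close> does not divide \<open>|A|\<close>, then \<open>V\<^sub>A\<close> is the sum of an odd part, on which the square root of
  \<open>c(Tu,Tu) / c(u,u)\<close> is a canonical choice of \<open>\<lambda>\<^sub>T(u)\<close>, and a plane over the field with two elements
  (or zero). On the plane, \<open>T\<close> permutes the three Pauli matrices, and multiplying this permutation
  by its sign yields a lift: the symmetric group on three letters inside the rotation group of
  the cube.\<close>

section \<open>Characters of finite abelian groups\<close>

text \<open>Written as a constant sum so that the laws of finite sums give additivity and
  compatibility with the projections of V_A.\<close>

definition nmul :: "nat \<Rightarrow> 'a::comm_monoid_add \<Rightarrow> 'a" where
  "nmul n a = (\<Sum>i<n. a)"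

lemma nmul_0 [simp]: "nmul 0 a = 0"
  and nmul_Suc [simp]: "nmul (Suc n) a = nmul n a + a"
  by (simp_all add: nmul_def)

lemma nmul_zero [simp]: "nmul n 0 = 0"
  by (simp add: nmul_def)

lemma nmul_plus: "nmul (m + n) a = nmul m a + nmul n a"
  by (induction n) (simp_all add: add_ac)

lemma nmul_nmul: "nmul m (nmul n a) = nmul (m * n) a"
  by (induction m) (simp_all add: nmul_plus add_ac)

lemma nmul_add: "nmul n (a + b) = nmul n a + nmul n b"
  by (simp add: nmul_def sum.distrib)

lemma nmul_two: "nmul 2 a = a + a"
  by (simp add: numeral_2_eq_2)

lemma sum_const_nmul: "finite A \<Longrightarrow> (\<Sum>b\<in>A. a) = nmul (card A) a"
  by (induction A rule: finite_induct) (simp_all add: add.commute)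

lemma fst_nmul: "fst (nmul n u) = nmul n (fst u)"
  and snd_nmul: "snd (nmul n u) = nmul n (snd u)"
  by (simp_all add: nmul_def fst_sum snd_sum)

lemma nmul_hom:
  assumes "\<And>u v. T (u + v) = T u + T v" "T 0 = 0"
  shows "T (nmul n u) = nmul n (T u)"
  by (induction n) (simp_all add: assms)

lemma dual_apply_nmul: "dual_apply c (nmul n a) = dual_apply c a ^ n"
  by (induction n) (simp_all add: dual_apply_add)

lemma dual_nmul_apply: "dual_apply (nmul n c) a = dual_apply c a ^ n"
  by (induction n) simp_all

lemma dual_eqI: "(\<And>a. dual_apply c a = dual_apply d a) \<Longrightarrow> c = d"
  by (metis dual_apply_inject ext)

text \<open>Translation by \<open>a\<close> permutes the group, so the sum of all elements is
  unchanged although it gains |A| copies of \<open>a\<close>.\<close>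

lemma nmul_card_group: "nmul (CARD('a)) (a::'a::{ab_group_add,finite}) = 0"
proof -
  have "(\<Sum>b\<in>UNIV. b) = (\<Sum>b\<in>UNIV. a + b)"
    by (rule sum.reindex_bij_witness[of _ "\<lambda>b. a + b" "\<lambda>b. b - a"]) auto
  also have "\<dots> = nmul (CARD('a)) a + (\<Sum>b\<in>UNIV. b)"
    by (simp add: sum.distrib sum_const_nmul)
  finally show ?thesis by simp
qed

lemma dual_apply_pow_card: "dual_apply c (a::'a::{ab_group_add,finite}) ^ CARD('a) = 1"
  by (simp add: dual_apply_nmul[symmetric] nmul_card_group)

lemma dual_apply_uminus: "dual_apply c (- a) = inverse (dual_apply c a)"
  using dual_apply_add[of c a "- a"] by (simp add: inverse_unique)

text \<open>Characters take values in the |A|-th roots of unity, which leaves finitely many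
  functions. This makes V_A finite, as the averaging in \<open>intertwiner_exists\<close>
  requires.\<close>

instance dual :: ("{ab_group_add,finite}") finite
proof
  have "dual_apply c \<in> UNIV \<rightarrow>\<^sub>E {z. z ^ CARD('a) = 1}" for c :: "'a dual"
    by (auto simp: dual_apply_pow_card PiE_def extensional_def)
  then have "range (dual_apply :: 'a dual \<Rightarrow> _) \<subseteq> UNIV \<rightarrow>\<^sub>E {z. z ^ CARD('a) = 1}"
    by blast
  moreover have "finite (UNIV \<rightarrow>\<^sub>E {z::complex. z ^ CARD('a) = 1} :: ('a \<Rightarrow> complex) set)"
    by (intro finite_PiE) (simp_all add: finite_roots_unity)
  ultimately have "finite (range (dual_apply :: 'a dual \<Rightarrow> _))"
    by (rule finite_subset)
  then show "finite (UNIV :: 'a dual set)"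
    by (rule finite_imageD) (meson dual_apply_inject injI)
qed

section \<open>Extending characters from subgroups\<close>

definition add_subgroup :: "'a::ab_group_add set \<Rightarrow> bool" where
  "add_subgroup H \<longleftrightarrow> 0 \<in> H \<and> (\<forall>a\<in>H. \<forall>b\<in>H. a - b \<in> H)"

lemma add_subgroupD:
  assumes "add_subgroup H"
  shows "0 \<in> H" "a \<in> H \<Longrightarrow> b \<in> H \<Longrightarrow> a - b \<in> H" "a \<in> H \<Longrightarrow> - a \<in> H"
    "a \<in> H \<Longrightarrow> b \<in> H \<Longrightarrow> a + b \<in> H"
proof -
  show 0: "0 \<in> H" and d: "a \<in> H \<Longrightarrow> b \<in> H \<Longrightarrow> a - b \<in> H" for a b
    using assms by (auto simp: add_subgroup_def)
  show m: "a \<in> H \<Longrightarrow> - a \<in> H" for a using d[OF 0, of a] by simp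
  show "a \<in> H \<Longrightarrow> b \<in> H \<Longrightarrow> a + b \<in> H" using d[of a "- b"] m[of b] by simp
qed

lemma add_subgroup_nmul: "add_subgroup H \<Longrightarrow> a \<in> H \<Longrightarrow> nmul n a \<in> H"
  by (induction n) (auto simp: add_subgroupD)

definition partial_char :: "'a::ab_group_add set \<Rightarrow> ('a \<Rightarrow> complex) \<Rightarrow> bool" where
  "partial_char H f \<longleftrightarrow> add_subgroup H \<and> (\<forall>a\<in>H. norm (f a) = 1) \<and>
     (\<forall>a\<in>H. \<forall>b\<in>H. f (a + b) = f a * f b)"

lemma partial_char_nmul:
  assumes "partial_char H f" "a \<in> H"
  shows "f (nmul n a) = f a ^ n"
proof (induction n)
  case 0
  have 0: "0 \<in> H" using assms(1) by (simp add: partial_char_def add_subgroupD(1))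
  then have "f 0 = f 0 * f 0" "norm (f 0) = 1"
    using assms(1) unfolding partial_char_def by (metis add_0, blast)
  then have "f 0 = 1" by auto
  then show ?case by simp
next
  case (Suc n)
  then show ?case using assms
    by (simp add: partial_char_def add_subgroup_nmul)
qed

text \<open>Avoiding the root 1 is what makes an extended character nontrivial at the new element.
  If \<open>w\<close> is not 1, every root qualifies.\<close>

lemma exists_root_neq_1:
  fixes w :: complex
  assumes "norm w = 1" "k \<ge> 2"
  shows "\<exists>z. z ^ k = w \<and> norm z = 1 \<and> z \<noteq> 1"
proof (cases "w = 1")
  case True
  have "card {z::complex. z ^ k = 1} = k" using assms(2) by (intro card_roots_unity_eq) auto
  then have "{z::complex. z ^ k = 1} \<noteq> {1}" "{z::complex. z ^ k = 1} \<noteq> {}" using assms(2) by force+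
  then obtain z :: complex where z: "z ^ k = 1" "z \<noteq> 1" by blast
  then have "norm z ^ k = 1" by (metis norm_one norm_power)
  then have "norm z = 1" using assms(2) power_eq_1_iff[of "norm z" k] by auto
  then show ?thesis using z True by blast
next
  case False
  have "cis (Arg w / k) ^ k = w"
  proof -
    have "w \<noteq> 0" using assms(1) by auto
    then have "cis (Arg w) = w" using assms(1) by (simp add: cis_Arg sgn_eq)
    then show ?thesis unfolding Complex.DeMoivre using assms(2) by simp
  qed
  then show ?thesis using False by (intro exI[of _ "cis (Arg w / k)"]) auto
qed

text \<open>The extension sends h + jy to f(h) z^j, where k is the order of \<open>y\<close> modulo
  \<open>H\<close> and z is a k-th root of f(ky).\<close>

lemma partial_char_extend:
  fixes y :: "'a::{ab_group_add,finite}"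
  assumes f: "partial_char H f" and y: "y \<notin> H"
  shows "\<exists>H' f'. partial_char H' f' \<and> H \<subseteq> H' \<and> y \<in> H' \<and> (\<forall>a\<in>H. f' a = f a) \<and> f' y \<noteq> 1"
proof -
  have H: "add_subgroup H" using f by (simp add: partial_char_def)
  define k where "k = (LEAST k. 0 < k \<and> nmul k y \<in> H)"
  have ex: "0 < CARD('a) \<and> nmul (CARD('a)) y \<in> H"
    by (simp add: nmul_card_group add_subgroupD(1)[OF H])
  have k: "0 < k" "nmul k y \<in> H"
    unfolding k_def using LeastI[of "\<lambda>k. 0 < k \<and> nmul k y \<in> H", OF ex] by auto
  have least: "\<not> (0 < r \<and> nmul r y \<in> H)" if "r < k" for r
    using that unfolding k_def by (rule not_less_Least)
  have "k \<noteq> 1" using k(2) y by auto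
  then obtain z where z: "z ^ k = f (nmul k y)" "norm z = 1" "z \<noteq> 1"
    using exists_root_neq_1[of "f (nmul k y)" k] f k by (auto simp: partial_char_def)
  \<comment> \<open>By minimality of \<open>k\<close>, a multiple of \<open>y\<close> lies in
    \<open>H\<close> only if \<open>k\<close> divides the multiplier, so the powers of
    \<open>z\<close> agree with \<open>f\<close> on \<open>H\<close>.\<close>
  have fz: "f (nmul i y) = z ^ i" if "nmul i y \<in> H" for i
  proof -
    have i: "nmul i y = nmul (i mod k) y + nmul (i div k) (nmul k y)"
      by (simp add: nmul_nmul nmul_plus[symmetric])
    have "nmul (i mod k) y \<in> H"
      using that add_subgroupD(2)[OF H _ add_subgroup_nmul[OF H k(2), of "i div k"]] i by force
    then have "i mod k = 0" using least[of "i mod k"] k(1) by auto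
    then have "k * (i div k) = i" "nmul i y = nmul (i div k) (nmul k y)" using i by auto
    then show ?thesis
      using partial_char_nmul[OF f k(2), of "i div k"] by (metis z(1) power_mult)
  qed
  define H' where "H' = {h + nmul j y | h j. h \<in> H}"
  have wd: "f h * z ^ j = f h' * z ^ j'"
    if "h \<in> H" "h' \<in> H" "h + nmul j y = h' + nmul j' y" "j \<le> j'" for h h' j j'
  proof -
    have h: "h = h' + nmul (j' - j) y"
      using that(3,4) nmul_plus[of "j' - j" j y] by (simp add: add.assoc[symmetric])
    then have "nmul (j' - j) y \<in> H" using add_subgroupD(2)[OF H that(1,2)] by simp
    then have "f h = f h' * z ^ (j' - j)"
      using fz f h that(2) by (simp add: partial_char_def)
    then show ?thesis using that(4) by (simp add: power_add[symmetric])
  qed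
  define f' where "f' a = (THE w. \<exists>h\<in>H. \<exists>j. a = h + nmul j y \<and> w = f h * z ^ j)" for a
  have f': "f' (h + nmul j y) = f h * z ^ j" if "h \<in> H" for h j
    unfolding f'_def
  proof (rule the_equality)
    fix w assume "\<exists>h'\<in>H. \<exists>j'. h + nmul j y = h' + nmul j' y \<and> w = f h' * z ^ j'"
    then obtain h' j' where "h' \<in> H" "h + nmul j y = h' + nmul j' y" "w = f h' * z ^ j'" by blast
    then show "w = f h * z ^ j"
      using wd[of h h' j j'] wd[of h' h j' j] that by (cases "j \<le> j'") auto
  qed (use that in blast)
  have f0: "f 0 = 1" using fz[of 0] add_subgroupD(1)[OF H] by simp
  \<comment> \<open>Multipliers are natural numbers, so closure under subtraction replaces -1 by |A|
    - 1.\<close>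
  have yneg: "- nmul j y = nmul (j * (CARD('a) - 1)) y" for j
  proof -
    have "nmul j y + nmul (j * (CARD('a) - 1)) y = nmul (j + j * (CARD('a) - 1)) y"
      by (simp add: nmul_plus)
    also have "j + j * (CARD('a) - 1) = j * CARD('a)"
      using zero_less_card_finite[where 'a='a] by (cases "CARD('a)") (auto simp: algebra_simps)
    also have "nmul (j * CARD('a)) y = 0" by (simp add: nmul_nmul[symmetric] nmul_card_group)
    finally show ?thesis by (simp add: minus_unique)
  qed
  have plus: "h + nmul j y + (h' + nmul j' y) = (h + h') + nmul (j + j') y" for h h' j j'
    by (simp add: nmul_plus algebra_simps)
  have "add_subgroup H'"
    unfolding add_subgroup_def
  proof (intro conjI ballI)
    show "0 \<in> H'" unfolding H'_def using add_subgroupD(1)[OF H]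
      by (auto intro!: exI[of _ 0] exI[of _ "0::nat"])
    fix a b assume "a \<in> H'" "b \<in> H'"
    then obtain h j h' j' where *: "a = h + nmul j y" "b = h' + nmul j' y" "h \<in> H" "h' \<in> H"
      unfolding H'_def by blast
    have "a - b = (h - h') + (nmul j y + - nmul j' y)" by (simp add: *)
    then have "a - b = (h - h') + nmul (j + j' * (CARD('a) - 1)) y"
      by (simp only: yneg nmul_plus)
    then show "a - b \<in> H'" unfolding H'_def using add_subgroupD(2)[OF H] * by blast
  qed
  moreover have "norm (f' a) = 1" if "a \<in> H'" for a
    using that f z(2) unfolding H'_def by (auto simp: f' norm_mult norm_power partial_char_def)
  moreover have "f' (a + b) = f' a * f' b" if ab: "a \<in> H'" "b \<in> H'" for a b
  proof -
    obtain h j h' j' where *: "a = h + nmul j y" "b = h' + nmul j' y" "h \<in> H" "h' \<in> H"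
      using ab unfolding H'_def by blast
    then have "f (h + h') = f h * f h'" using f by (simp add: partial_char_def)
    then show ?thesis
      unfolding * plus using * add_subgroupD(4)[OF H] by (simp add: f' power_add)
  qed
  ultimately have "partial_char H' f'" by (simp add: partial_char_def)
  moreover have "H \<subseteq> H'" unfolding H'_def by (force intro: exI[of _ "0::nat"])
  moreover have "y \<in> H'" unfolding H'_def using add_subgroupD(1)[OF H]
    by (auto intro!: exI[of _ 0] exI[of _ "1::nat"])
  moreover have "\<forall>a\<in>H. f' a = f a" using f'[of _ 0] by simp
  moreover have "f' y = z" using f'[of 0 1] f0 add_subgroupD(1)[OF H] by simp
  ultimately show ?thesis using z(3) by blast
qed

lemma partial_char_extend_dual:
  fixes H :: "'a::{ab_group_add,finite} set"
  assumes "partial_char H f"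
  shows "\<exists>c. \<forall>a\<in>H. dual_apply c a = f a"
  using assms
proof (induction "card (- H)" arbitrary: H f rule: less_induct)
  case less
  show ?case
  proof (cases "H = UNIV")
    case True
    then have "dual_apply (Abs_dual f) = f"
      using less.prems by (intro Abs_dual_inverse) (auto simp: partial_char_def)
    then show ?thesis by metis
  next
    case False
    then obtain y where y: "y \<notin> H" by blast
    obtain H' f' where e: "partial_char H' f'" "H \<subseteq> H'" "y \<in> H'" "\<forall>a\<in>H. f' a = f a"
      using partial_char_extend[OF less.prems y] by blast
    have "card (- H') < card (- H)" using e y by (intro psubset_card_mono) auto
    from less.hyps[OF this e(1)] show ?thesis using e(2,4) by (metis subsetD)
  qed
qed

text \<open>The trivial character of \<open>H\<close> is first extended to one that differs from 1
  at \<open>x\<close>; the further extension to the whole group keeps this value.\<close>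

lemma dual_separates:
  fixes x :: "'a::{ab_group_add,finite}"
  assumes "add_subgroup H" "x \<notin> H"
  shows "\<exists>c. (\<forall>a\<in>H. dual_apply c a = 1) \<and> dual_apply c x \<noteq> 1"
proof -
  have "partial_char H (\<lambda>_. 1)" using assms(1) by (simp add: partial_char_def)
  from partial_char_extend[OF this assms(2)] obtain H' f' where
    *: "partial_char H' f'" "H \<subseteq> H'" "x \<in> H'" "\<forall>a\<in>H. f' a = 1" "f' x \<noteq> 1" by blast
  from partial_char_extend_dual[OF *(1)] * show ?thesis by (metis subsetD)
qed

lemma dual_separates_points:
  fixes x :: "'a::{ab_group_add,finite}"
  assumes "x \<noteq> y" shows "\<exists>c. dual_apply c x \<noteq> dual_apply c y"
proof -
  have "add_subgroup {0::'a}" by (simp add: add_subgroup_def)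
  from dual_separates[OF this, of "x - y"] assms obtain c where c: "dual_apply c (x - y) \<noteq> 1" by auto
  have "dual_apply c x = dual_apply c (x - y) * dual_apply c y"
    by (metis diff_add_cancel dual_apply_add)
  with c show ?thesis by (intro exI[of _ c]) auto
qed

lemma sum_dual_apply:
  fixes c :: "'a::{ab_group_add,finite} dual"
  assumes "c \<noteq> 0" shows "(\<Sum>a\<in>UNIV. dual_apply c a) = 0"
proof -
  obtain b where b: "dual_apply c b \<noteq> 1" using assms dual_eqI[of c 0] by auto
  have "(\<Sum>a\<in>UNIV. dual_apply c a) = (\<Sum>a\<in>UNIV. dual_apply c (b + a))"
    by (rule sum.reindex_bij_witness[of _ "\<lambda>a. b + a" "\<lambda>a. a - b"]) auto
  also have "\<dots> = dual_apply c b * (\<Sum>a\<in>UNIV. dual_apply c a)"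
    by (simp add: dual_apply_add sum_distrib_left)
  finally show ?thesis using b by (simp add: algebra_simps)
qed

section \<open>Parity counts and elements of order two\<close>

lemma card_involution_parity:
  assumes "finite S" "\<And>x. x \<in> S \<Longrightarrow> f x \<in> S" "\<And>x. x \<in> S \<Longrightarrow> f (f x) = x"
  shows "even (card S) \<longleftrightarrow> even (card {x\<in>S. f x = x})"
  using assms
proof (induction "card S" arbitrary: S rule: less_induct)
  case less
  show ?case
  proof (cases "\<exists>x\<in>S. f x \<noteq> x")
    case True
    then obtain x where x: "x \<in> S" "f x \<noteq> x" by blast
    \<comment> \<open>Removing a moved point together with its image changes neither the parity nor
      the fixed points.\<close>
    let ?S = "S - {x, f x}"
    have c: "card S = card ?S + 2"
      using x less.prems card_Diff_subset[of "{x, f x}" S] card_mono[of S "{x, f x}"] by auto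
    have "f y \<in> ?S" if "y \<in> ?S" for y
      using that less.prems(2,3) x by (metis DiffD1 DiffD2 DiffI insert_iff singletonD)
    then have "even (card ?S) \<longleftrightarrow> even (card {y\<in>?S. f y = y})"
      using less.prems c by (intro less.hyps) auto
    moreover have "{y\<in>?S. f y = y} = {y\<in>S. f y = y}" using x less.prems(3) by auto
    ultimately show ?thesis using c by simp
  next
    case False
    then have "{x\<in>S. f x = x} = S" by blast
    then show ?thesis by simp
  qed
qed

text \<open>The nonempty fibres of \<open>f\<close> are translates of \<open>K\<close>, so they all
  have the same size.\<close>

lemma card_hom_image:
  fixes f :: "'a::{ab_group_add,finite} \<Rightarrow> 'b"
  assumes "\<And>a b. f a = f b \<longleftrightarrow> a - b \<in> K"
  shows "CARD('a) = card K * card (range f)"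
proof -
  have "card {a. f a = y} = card K" if y: "y \<in> range f" for y
  proof -
    from y obtain b where b: "y = f b" by blast
    have "{a. f a = y} = (\<lambda>k. k + b) ` K" (is "?L = ?R")
    proof (intro equalityI subsetI)
      fix a assume "a \<in> ?L"
      then have "a - b \<in> K" using assms b by auto
      then show "a \<in> ?R" by (intro image_eqI[of _ _ "a - b"]) auto
    next
      fix a assume "a \<in> ?R" then show "a \<in> ?L" using assms b by auto
    qed
    then show ?thesis by (simp add: card_image)
  qed
  then have "(\<Sum>y\<in>range f. card {a\<in>UNIV. f a = y}) = card K * card (range f)" by simp
  moreover have "CARD('a) = (\<Sum>y\<in>range f. card {a\<in>UNIV. f a = y})"
    using sum.image_gen[of "UNIV::'a set" "\<lambda>_. 1::nat" f] by simp
  ultimately show ?thesis by simp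
qed

text \<open>Cauchy's theorem for the prime 2. Negation fixes 0, so even order forces a second fixed
  point; conversely, translation by an involution has no fixed point.\<close>

lemma even_card_subgroup_iff:
  fixes H :: "'a::{ab_group_add,finite} set"
  assumes "add_subgroup H"
  shows "even (card H) \<longleftrightarrow> (\<exists>h\<in>H. h \<noteq> 0 \<and> h + h = 0)"
proof
  assume "even (card H)"
  then have e: "even (card {x\<in>H. - x = x})"
    using card_involution_parity[of H uminus] add_subgroupD[OF assms] by auto
  have "{x\<in>H. - x = x} \<noteq> {0}"
  proof
    assume "{x\<in>H. - x = x} = {0}"
    with e show False by (metis card.empty card.insert empty_iff finite.emptyI odd_one One_nat_def)
  qed
  moreover have "0 \<in> {x\<in>H. - x = x}" using add_subgroupD(1)[OF assms] by simp
  ultimately obtain h where "h \<in> H" "- h = h" "h \<noteq> 0" by blast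
  then show "\<exists>h\<in>H. h \<noteq> 0 \<and> h + h = 0" by (metis add.right_inverse)
next
  assume "\<exists>h\<in>H. h \<noteq> 0 \<and> h + h = 0"
  then obtain h where h: "h \<in> H" "h \<noteq> 0" "h + h = 0" by blast
  have "even (card {x\<in>H. x + h = x})" using h by simp
  then show "even (card H)"
    using card_involution_parity[of H "\<lambda>x. x + h"] add_subgroupD[OF assms] h
    by (simp add: add.assoc)
qed

section \<open>Unitary lifts of symplectic maps\<close>

declare split_paired_All [simp del] split_paired_Ex [simp del]

lemma matrix_sum_ldistrib: "(\<Sum>i\<in>S. A i) ** B = (\<Sum>i\<in>S. A i ** (B :: 'a::finite operator))"
  by (induction S rule: infinite_finite_induct)
     (simp_all add: vec_eq_iff matrix_matrix_mult_def ring_distribs sum.distrib)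

lemma matrix_sum_rdistrib: "B ** (\<Sum>i\<in>S. A i) = (\<Sum>i\<in>S. (B :: 'a::finite operator) ** A i)"
  by (induction S rule: infinite_finite_induct)
     (simp_all add: vec_eq_iff matrix_matrix_mult_def ring_distribs sum.distrib)

lemma adj_nth: "adj M $ i $ j = cnj (M $ j $ i)"
  by (simp add: adj_def)

lemma mat_eq_iff: "mat z = (mat w :: 'a::finite operator) \<longleftrightarrow> z = w"
  by (auto simp: vec_eq_iff mat_def)

abbreviation weyl_cocycle :: "'a::ab_group_add phase_space \<Rightarrow> 'a phase_space \<Rightarrow> complex" where
  "weyl_cocycle u v \<equiv> dual_apply (snd u) (fst v)"

text \<open>For additive \<open>T\<close>, the equation says that the operators
  \<open>mat (l u) ** weyl (T u)\<close> multiply with the same cocycle as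
  \<open>weyl u\<close>.\<close>

definition clifford_phase ::
  "('a::ab_group_add phase_space \<Rightarrow> 'a phase_space) \<Rightarrow> ('a phase_space \<Rightarrow> complex) \<Rightarrow> bool" where
  "clifford_phase T l \<longleftrightarrow> (\<forall>u. norm (l u) = 1) \<and>
     (\<forall>u v. l u * l v * weyl_cocycle (T u) (T v) = weyl_cocycle u v * l (u + v))"

definition implements ::
  "'a::{ab_group_add,finite} operator \<Rightarrow> ('a phase_space \<Rightarrow> 'a phase_space) \<Rightarrow>
     ('a phase_space \<Rightarrow> complex) \<Rightarrow> bool" where
  "implements U T l \<longleftrightarrow> U \<in> carrier unitary_group \<and> (\<forall>u. norm (l u) = 1) \<and>
     (\<forall>u. U ** weyl u ** adj U = mat (l u) ** weyl (T u))"

lemma implements_unitary: "implements U T l \<Longrightarrow> U ** adj U = mat 1 \<and> adj U ** U = mat 1"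
  by (simp add: implements_def unitary_carrier)

lemma conj_mult:
  fixes U :: "'a::finite operator"
  assumes "adj U ** U = mat 1"
  shows "U ** (M ** N) ** adj U = (U ** M ** adj U) ** (U ** N ** adj U)"
proof -
  have "(U ** M ** adj U) ** (U ** N ** adj U) = U ** M ** (adj U ** U) ** N ** adj U"
    by (simp only: matrix_mul_assoc)
  then show ?thesis by (simp add: assms matrix_mul_assoc)
qed

lemma implements_phase:
  assumes U: "implements U T l" and T: "\<And>u v. T (u + v) = T u + T v"
  shows "clifford_phase T l"
proof -
  have n: "norm (l u) = 1" and c: "U ** weyl u ** adj U = mat (l u) ** weyl (T u)" for u
    using U by (auto simp: implements_def)
  have "l u * l v * weyl_cocycle (T u) (T v) = weyl_cocycle u v * l (u + v)" for u v
  proof -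
    have "U ** (weyl u ** weyl v) ** adj U = mat (weyl_cocycle u v * l (u + v)) ** weyl (T (u + v))"
      by (simp only: weyl_mult scal_right[of U] scal_left c scal_scal)
    moreover have "U ** (weyl u ** weyl v) ** adj U
        = mat (l u * l v * weyl_cocycle (T u) (T v)) ** weyl (T u + T v)"
      unfolding conj_mult[OF conjunct2[OF implements_unitary[OF U]]] c scal_prod
      by (simp only: weyl_mult scal_scal)
    moreover have "weyl_cocycle u v * l (u + v) \<noteq> 0" using n[of "u + v"] by auto
    ultimately show ?thesis using weyl_proportional by metis
  qed
  then show ?thesis using n by (simp add: clifford_phase_def)
qed

lemma implements_comp:
  assumes "implements U S k" "implements V T l"
  shows "implements (U ** V) (S \<circ> T) (\<lambda>u. k (T u) * l u)"
proof -
  have k: "norm (k u) = 1" "U ** weyl u ** adj U = mat (k u) ** weyl (S u)" for u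
    using assms(1) by (auto simp: implements_def)
  have l: "norm (l u) = 1" "V ** weyl u ** adj V = mat (l u) ** weyl (T u)" for u
    using assms(2) by (auto simp: implements_def)
  have "(U ** V) ** weyl u ** adj (U ** V) = mat (k (T u) * l u) ** weyl (S (T u))" for u
  proof -
    have "(U ** V) ** weyl u ** adj (U ** V) = U ** (V ** weyl u ** adj V) ** adj U"
      by (simp only: adj_mult matrix_mul_assoc)
    also have "\<dots> = mat (l u) ** (U ** weyl (T u) ** adj U)"
      by (simp only: l(2) scal_right[of U] scal_left)
    finally show ?thesis by (simp only: k(2) scal_scal mult.commute)
  qed
  moreover have "U ** V \<in> carrier unitary_group"
    using monoid.m_closed[OF group.is_monoid[OF unitary_group_group], of U V] assms
    by (simp add: implements_def)
  ultimately show ?thesis using k(1) l(1) by (simp add: implements_def norm_mult)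
qed

section \<open>Schur's lemma and the Stone-von Neumann theorem\<close>

lemma weyl_commutant:
  fixes M :: "'a::{ab_group_add,finite} operator"
  assumes "\<And>u. M ** weyl u = weyl u ** M"
  shows "M = mat (M $ 0 $ 0)"
proof -
  have r: "(M ** weyl (a, c)) $ i $ j = M $ i $ (a + j) * dual_apply c j" for a c i j
    by (simp add: matrix_matrix_mult_def weyl_nth if_distrib[of "\<lambda>x. _ * x"] cong: if_cong)
  have l: "(weyl (a, c) ** M) $ (a + i) $ j = dual_apply c i * M $ i $ j" for a c i j
    by (simp add: matrix_matrix_mult_def weyl_nth if_distrib[of "\<lambda>x. x * _"] cong: if_cong)
  have "M $ i $ j = (if i = j then M $ 0 $ 0 else 0)" for i j
  proof (cases "i = j")
    case True
    have "M $ (i + 0) $ (i + 0) = M $ 0 $ 0"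
      using r[of i 0 "i + 0" 0] l[of i 0 0 0] assms[of "(i, 0)"] by simp
    then show ?thesis using True by simp
  next
    case False
    \<comment> \<open>The character scales the entry differently from the left and from the right,
      so the entry vanishes.\<close>
    then obtain c where c: "dual_apply c i \<noteq> dual_apply c j" using dual_separates_points by blast
    have "M $ i $ j * dual_apply c j = dual_apply c i * M $ i $ j"
      using r[of 0 c i j] l[of 0 c i j] assms[of "(0, c)"] by simp
    then show ?thesis using c False by auto
  qed
  then show ?thesis unfolding vec_eq_iff mat_def vec_lambda_beta by blast
qed

text \<open>\<open>adj U ** V\<close> commutes with every Weyl operator, hence is a scalar, and
  unitarity puts it on the unit circle.\<close>

lemma implements_unique:
  assumes U: "implements U T l" and V: "implements V T l"
  shows "\<exists>z. norm z = 1 \<and> V = mat z ** U"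
proof -
  let ?M = "adj U ** V"
  note u = implements_unitary[OF U] and v = implements_unitary[OF V]
  have "?M ** weyl w = weyl w ** ?M" for w
  proof -
    have e: "V ** weyl w ** adj V = U ** weyl w ** adj U"
      using U V by (simp add: implements_def)
    have "?M ** weyl w = adj U ** (V ** weyl w ** adj V) ** V"
      using v by (simp add: matrix_mul_assoc[symmetric])
    also have "\<dots> = (adj U ** U) ** weyl w ** adj U ** V"
      unfolding e by (simp only: matrix_mul_assoc)
    finally show ?thesis using u by (simp add: matrix_mul_assoc)
  qed
  then obtain z where z: "?M = mat z" using weyl_commutant by blast
  have "V = (U ** adj U) ** V" using u by simp
  also have "\<dots> = mat z ** U" by (simp only: matrix_mul_assoc[symmetric] z scal_commute)
  finally have V': "V = mat z ** U" .
  have "adj ?M ** ?M = mat 1"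
  proof -
    have "adj ?M ** ?M = adj V ** (U ** adj U) ** V"
      by (simp only: adj_mult adj_adj matrix_mul_assoc)
    then show ?thesis using u v by simp
  qed
  then have "cnj z * z = 1" by (simp only: z adj_mat mat_mult mat_eq_iff)
  then have "complex_of_real ((norm z)\<^sup>2) = 1" by (simp only: complex_norm_square mult.commute)
  then have "(norm z)\<^sup>2 = 1" by (simp only: of_real_eq_1_iff)
  then have "norm z = 1" by (metis abs_norm_cancel abs_square_eq_1)
  then show ?thesis using V' by blast
qed

lemma trace_weyl: "(\<Sum>i\<in>UNIV. weyl u $ i $ i) = (if u = 0 then of_nat CARD('a) else 0)"
  for u :: "'a::{ab_group_add,finite} phase_space"
proof (cases "fst u = 0")
  case True
  then have "(\<Sum>i\<in>UNIV. weyl u $ i $ i) = (\<Sum>i\<in>UNIV. dual_apply (snd u) i)"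
    by (simp add: weyl_nth)
  then show ?thesis using True sum_dual_apply[of "snd u"] by (auto simp: prod_eq_iff)
qed (auto simp: weyl_nth)

text \<open>Stone--von Neumann: an intertwiner of \<open>weyl\<close> with another representation \<open>R\<close> of the same
  cocycle arises by averaging a matrix unit; traces show that some average is nonzero.\<close>

lemma intertwiner_exists:
  fixes R :: "'a::{ab_group_add,finite} phase_space \<Rightarrow> 'a operator"
  assumes R: "\<And>u v. R u ** R v = mat (weyl_cocycle u v) ** R (u + v)" and R0: "R 0 \<noteq> 0"
  shows "\<exists>U. U \<noteq> 0 \<and> (\<forall>v. R v ** U = U ** weyl v)"
proof -
  define I where "I M = (\<Sum>u\<in>UNIV. R u ** M ** adj (weyl u))" for M
  have inter: "R v ** I M = I M ** weyl v" for v M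
  proof -
    \<comment> \<open>This turns the summand at \<open>u\<close>, multiplied by \<open>R v\<close>,
      into the summand at \<open>v + u\<close> followed by \<open>weyl v\<close>, ready for
      reindexing.\<close>
    have adjw: "mat (weyl_cocycle v u) ** adj (weyl u) = adj (weyl (v + u)) ** weyl v" for u
    proof -
      let ?z = "weyl_cocycle v u"
      have "adj (weyl u) ** adj (weyl v) = mat (cnj ?z) ** adj (weyl (v + u))"
        using arg_cong[OF weyl_mult[of v u], of adj] by (simp add: adj_mult scal_commute)
      then have "mat ?z ** (adj (weyl u) ** adj (weyl v)) ** weyl v
          = mat (?z * cnj ?z) ** adj (weyl (v + u)) ** weyl v"
        by (simp only: scal_scal)
      then show ?thesis by (simp add: matrix_mul_assoc[symmetric] weyl_unitary unit_cnj)
    qed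
    have "R v ** I M = (\<Sum>u\<in>UNIV. R (v + u) ** M ** (mat (weyl_cocycle v u) ** adj (weyl u)))"
      unfolding I_def matrix_sum_rdistrib
    proof (rule sum.cong[OF refl])
      fix u
      have "R v ** (R u ** M ** adj (weyl u))
          = mat (weyl_cocycle v u) ** (R (v + u) ** M ** adj (weyl u))"
        by (simp only: R matrix_mul_assoc)
      also have "\<dots> = R (v + u) ** M ** (mat (weyl_cocycle v u) ** adj (weyl u))"
        by (rule scal_right[symmetric])
      finally show "R v ** (R u ** M ** adj (weyl u))
          = R (v + u) ** M ** (mat (weyl_cocycle v u) ** adj (weyl u))" .
    qed
    also have "\<dots> = (\<Sum>u\<in>UNIV. R (v + u) ** M ** adj (weyl (v + u)) ** weyl v)"
      by (simp only: adjw matrix_mul_assoc)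
    also have "\<dots> = (\<Sum>u\<in>UNIV. R u ** M ** adj (weyl u) ** weyl v)"
      by (rule sum.reindex_bij_witness[of _ "\<lambda>u. u - v" "\<lambda>u. v + u"]) auto
    finally show ?thesis by (simp only: I_def matrix_sum_ldistrib)
  qed
  have "\<exists>M. I M \<noteq> 0"
  proof (rule ccontr)
    assume "\<not> (\<exists>M. I M \<noteq> 0)"
    then have I0: "I M = 0" for M by blast
    have "R 0 $ k $ i = 0" for k i
    proof -
      have "(\<Sum>u\<in>UNIV. R u $ k $ i * cnj (weyl u $ j $ j)) = 0" for j
      proof -
        \<comment> \<open>Averaging this matrix unit isolates an entry of \<open>R u\<close> times
          one diagonal entry of \<open>weyl u\<close>. Summing over \<open>j\<close> below produces
          the trace, which keeps only \<open>u = 0\<close>.\<close>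
        define E :: "'a operator" where "E = (\<chi> p q. if p = i then (if q = j then 1 else 0) else 0)"
        have 1: "(R u ** E) $ k $ q = (if q = j then R u $ k $ i else 0)" for u q
          by (simp add: matrix_matrix_mult_def E_def if_distrib[of "\<lambda>x. _ * x"] cong: if_cong)
        have "(R u ** E ** adj (weyl u)) $ k $ j = (\<Sum>q\<in>UNIV. (R u ** E) $ k $ q * cnj (weyl u $ j $ q))" for u
          by (simp add: matrix_matrix_mult_def adj_nth)
        then have "(R u ** E ** adj (weyl u)) $ k $ j = R u $ k $ i * cnj (weyl u $ j $ j)" for u
          by (simp add: 1 if_distrib[of "\<lambda>x. x * _"] cong: if_cong)
        then have "I E $ k $ j = (\<Sum>u\<in>UNIV. R u $ k $ i * cnj (weyl u $ j $ j))"
          by (simp add: I_def)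
        then show ?thesis by (simp add: I0)
      qed
      then have "0 = (\<Sum>j\<in>UNIV. \<Sum>u\<in>UNIV. R u $ k $ i * cnj (weyl u $ j $ j))" by simp
      also have "\<dots> = (\<Sum>u\<in>UNIV. \<Sum>j\<in>UNIV. R u $ k $ i * cnj (weyl u $ j $ j))" by (rule sum.swap)
      also have "\<dots> = (\<Sum>u\<in>UNIV. R u $ k $ i * cnj (\<Sum>j\<in>UNIV. weyl u $ j $ j))"
        by (simp add: sum_distrib_left)
      also have "\<dots> = R 0 $ k $ i * of_nat CARD('a)"
        by (simp add: trace_weyl if_distrib[of cnj] if_distrib[of "\<lambda>x. _ * x"] cong: if_cong)
      finally show ?thesis by simp
    qed
    then show False using R0 by (simp add: vec_eq_iff)
  qed
  then show ?thesis using inter by metis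
qed

text \<open>For an intertwiner \<open>U\<close>, the product \<open>adj U ** U\<close> commutes with
  all Weyl operators, so it is a scalar. As a sum of squared absolute values this scalar is
  positive, and \<open>U\<close> can be rescaled to a unitary.\<close>

lemma unitary_intertwiner_exists:
  fixes R :: "'a::{ab_group_add,finite} phase_space \<Rightarrow> 'a operator"
  assumes R: "\<And>u v. R u ** R v = mat (weyl_cocycle u v) ** R (u + v)"
    and unit: "\<And>u. adj (R u) ** R u = mat 1" and R0: "R 0 \<noteq> 0"
  shows "\<exists>U\<in>carrier unitary_group. \<forall>v. U ** weyl v ** adj U = R v"
proof -
  obtain U where U: "U \<noteq> 0" "\<And>v. R v ** U = U ** weyl v"
    using intertwiner_exists[of R] R R0 by blast
  have "adj U ** U ** weyl v = weyl v ** (adj U ** U)" for v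
  proof -
    have "adj U ** U ** weyl v = adj U ** (R v ** U)"
      by (simp only: U(2) matrix_mul_assoc)
    also have "\<dots> = weyl v ** adj (weyl v) ** adj U ** R v ** U"
      by (simp add: weyl_unitary matrix_mul_assoc)
    also have "\<dots> = weyl v ** adj (U ** weyl v) ** R v ** U"
      by (simp only: adj_mult matrix_mul_assoc)
    also have "\<dots> = weyl v ** adj U ** (adj (R v) ** R v) ** U"
      by (simp only: U(2)[symmetric] adj_mult matrix_mul_assoc)
    finally show ?thesis by (simp add: unit matrix_mul_assoc)
  qed
  then have "adj U ** U = mat ((adj U ** U) $ 0 $ 0)" by (rule weyl_commutant)
  then obtain z where z: "adj U ** U = mat z" by blast
  have zr: "z = complex_of_real (\<Sum>k\<in>UNIV. (norm (U $ k $ i))\<^sup>2)" for i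
  proof -
    have "z = (adj U ** U) $ i $ i" unfolding z by (simp add: mat_def)
    also have "\<dots> = (\<Sum>k\<in>UNIV. U $ k $ i * cnj (U $ k $ i))"
      by (simp add: matrix_matrix_mult_def adj_nth mult.commute)
    finally show ?thesis by (simp only: of_real_sum complex_norm_square)
  qed
  obtain k i where "U $ k $ i \<noteq> 0" using U(1) by (auto simp: vec_eq_iff)
  then have pos: "(\<Sum>k\<in>UNIV. (norm (U $ k $ i))\<^sup>2) > 0" (is "?r > 0")
    by (intro sum_pos2[of _ k]) auto
  define s where "s = complex_of_real (1 / sqrt ?r)"
  have s: "cnj s * s * z = 1"
  proof -
    have "cnj s * s * z = complex_of_real ((1 / sqrt ?r) * (1 / sqrt ?r) * ?r)"
      unfolding s_def zr[of i] complex_cnj_complex_of_real by (simp only: of_real_mult)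
    also have "(1 / sqrt ?r) * (1 / sqrt ?r) * ?r = 1" using pos by (simp add: field_simps)
    finally show ?thesis by simp
  qed
  let ?U = "mat s ** U"
  have "adj ?U ** ?U = mat (cnj s * s * z)"
  proof -
    have "adj ?U ** ?U = (mat (cnj s) ** adj U) ** (mat s ** U)"
      by (simp only: adj_mult adj_mat scal_commute)
    also have "\<dots> = mat (cnj s * s) ** mat z" by (simp only: scal_prod z)
    finally show ?thesis by (simp only: mat_mult)
  qed
  then have 1: "adj ?U ** ?U = mat 1" by (simp only: s)
  then have 2: "?U ** adj ?U = mat 1" by (simp add: matrix_left_right_inverse)
  have "?U ** weyl v ** adj ?U = R v" for v
  proof -
    have "?U ** weyl v = R v ** ?U" by (simp only: scal_left U(2)[symmetric] scal_right)
    then have "?U ** weyl v ** adj ?U = R v ** (?U ** adj ?U)" by (simp only: matrix_mul_assoc)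
    then show ?thesis by (simp only: 2 matrix_mul_rid)
  qed
  then show ?thesis using 1 2 by (intro bexI[of _ ?U]) (auto simp: unitary_carrier)
qed

lemma Sp_groupD:
  assumes "T \<in> carrier Sp_group"
  shows "bij T" "T (u + v) = T u + T v" "symp_form (T u) (T v) = symp_form u v" "T 0 = 0"
proof -
  show "bij T" and a: "T (u + v) = T u + T v" for u v
    using assms unfolding Sp_group_def by auto
  show "symp_form (T u) (T v) = symp_form u v"
    using assms unfolding Sp_group_def partial_object.select_convs mem_Collect_eq by blast
  show "T 0 = 0" using a[of 0 0] by simp
qed

lemma implements_exists:
  fixes T :: "'a::{ab_group_add,finite} phase_space \<Rightarrow> 'a phase_space"
  assumes T: "\<And>u v. T (u + v) = T u + T v" and l: "clifford_phase T l"
  shows "\<exists>U. implements U T l"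
proof -
  have n: "norm (l u) = 1"
    and c: "l u * l v * weyl_cocycle (T u) (T v) = weyl_cocycle u v * l (u + v)" for u v
    using l unfolding clifford_phase_def by blast+
  define R where "R u = mat (l u) ** weyl (T u)" for u
  have "R u ** R v = mat (weyl_cocycle u v) ** R (u + v)" for u v
    by (simp only: R_def scal_prod weyl_mult scal_scal c T)
  moreover have "adj (R u) ** R u = mat 1" for u
  proof -
    have "adj (R u) ** R u = (mat (cnj (l u)) ** adj (weyl (T u))) ** (mat (l u) ** weyl (T u))"
      by (simp only: R_def adj_mult adj_mat scal_commute)
    then show ?thesis using n[of u] by (simp add: scal_prod weyl_unitary unit_cnj)
  qed
  moreover have "R 0 \<noteq> 0"
  proof
    assume "R 0 = 0"
    with calculation(2)[of 0] have "mat 1 = (0 :: 'a operator)"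
      by (simp add: matrix_matrix_mult_def vec_eq_iff)
    then show False using mat_eq_iff[of 1 0, where 'a='a] by simp
  qed
  ultimately obtain U where "U \<in> carrier unitary_group" "\<forall>v. U ** weyl v ** adj U = R v"
    using unitary_intertwiner_exists[of R] by blast
  then show ?thesis using n by (auto simp: implements_def R_def)
qed

lemma implements_normalizer:
  fixes T :: "'a::{ab_group_add,finite} phase_space \<Rightarrow> 'a phase_space"
  assumes U: "implements U T l" and "bij T"
  shows "U \<in> normalizer unitary_group heisenberg"
proof -
  define c where "c M = U ** M ** adj U" for M
  have n: "norm (l u) = 1" for u using U by (simp add: implements_def)
  have c: "c (mat z ** weyl u) = mat (z * l u) ** weyl (T u)" for z u
    using U by (simp only: c_def scal_right[of U] scal_left implements_def scal_scal)
  have "c ` heisenberg \<subseteq> heisenberg"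
  proof
    fix M assume "M \<in> c ` heisenberg"
    then obtain z u where "M = c (mat z ** weyl u)" and z: "norm z = 1" by (auto simp: heisenberg_def)
    then have "M = mat (z * l u) ** weyl (T u)" by (simp only: c)
    moreover have "norm (z * l u) = 1" using z n by (simp add: norm_mult)
    ultimately show "M \<in> heisenberg" unfolding heisenberg_def by blast
  qed
  moreover have "heisenberg \<subseteq> c ` heisenberg"
  proof
    fix M :: "'a operator" assume "M \<in> heisenberg"
    then obtain z v where M: "M = mat z ** weyl v" and z: "norm z = 1" by (auto simp: heisenberg_def)
    obtain u where u: "v = T u" using assms(2) by (metis bij_pointE)
    have "l u \<noteq> 0" using n[of u] by auto
    then have "M = c (mat (z / l u) ** weyl u)" by (simp add: c M u)
    moreover have "norm (z / l u) = 1" using z n by (simp add: norm_divide)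
    then have "mat (z / l u) ** weyl u \<in> heisenberg" unfolding heisenberg_def by blast
    ultimately show "M \<in> c ` heisenberg" by (rule image_eqI)
  qed
  ultimately show ?thesis
    using U unfolding normalizer_heisenberg c_def[abs_def] implements_def by blast
qed

section \<open>From splittings to coherent families of phases\<close>

abbreviation phase_class :: "'a::{ab_group_add,finite} operator \<Rightarrow> 'a operator set" where
  "phase_class U \<equiv> phases #>\<^bsub>clifford_unitaries\<^esub> U"

lemma phase_class_mult:
  assumes "U \<in> normalizer unitary_group heisenberg" "V \<in> normalizer unitary_group heisenberg"
  shows "phase_class U \<otimes>\<^bsub>clifford_group\<^esub> phase_class V = phase_class (U ** V)"
  using normal.rcos_sum[OF phases_normal, of U V] assms by (simp add: clifford_group_def)

lemma phase_class_eqD: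
  assumes "phase_class U = phase_class V" shows "\<exists>z. norm z = 1 \<and> U = mat z ** V"
proof -
  have "mat 1 ** U \<in> phase_class V"
    unfolding assms[symmetric] unfolding coset_phases using norm_one[where 'a=complex] by blast
  then show ?thesis unfolding coset_phases by auto
qed

lemma phase_class_scal:
  assumes "norm z = 1" shows "phase_class (mat z ** U) = phase_class U"
proof -
  have "\<exists>y. mat x ** U = mat (y * z) ** U \<and> norm y = 1" if "norm x = 1" for x
    using assms that by (intro exI[of _ "x / z"]) (auto simp: norm_divide)
  then show ?thesis using assms unfolding coset_phases scal_scal by (auto simp: norm_mult)
qed

text \<open>A class determines its phase function because scalars cancel under conjugation, and a
  phase function determines its class by \<open>implements_unique\<close>. Under this dictionary,
  multiplicativity becomes the composition law.\<close>

lemma splitting_iff_phases: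
  "(\<exists>\<sigma> \<in> hom (Sp_group :: ('a::{ab_group_add,finite} phase_space \<Rightarrow> 'a phase_space) monoid)
        clifford_group. \<forall>T \<in> carrier Sp_group. clifford_proj (\<sigma> T) = T) \<longleftrightarrow>
   (\<exists>l. (\<forall>T \<in> carrier (Sp_group :: ('a phase_space \<Rightarrow> 'a phase_space) monoid). clifford_phase T (l T)) \<and>
      (\<forall>S \<in> carrier Sp_group. \<forall>T \<in> carrier Sp_group. \<forall>u. l (S \<circ> T) u = l S (T u) * l T u))"
  (is "?L \<longleftrightarrow> ?R")
proof
  assume ?L
  then obtain \<sigma> where hom: "\<sigma> \<in> hom Sp_group clifford_group"
    and proj: "\<And>T. T \<in> carrier Sp_group \<Longrightarrow> clifford_proj (\<sigma> T) = (T :: 'a phase_space \<Rightarrow> _)" by blast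
  have "\<exists>U l. U \<in> normalizer unitary_group heisenberg \<and> \<sigma> T = phase_class U \<and> implements U T l"
    if T: "T \<in> carrier Sp_group" for T :: "'a phase_space \<Rightarrow> _"
  proof -
    have "\<sigma> T \<in> carrier clifford_group" using hom T by (auto simp: hom_def)
    then obtain U where U: "U \<in> normalizer unitary_group heisenberg" "\<sigma> T = phase_class U"
      by (auto simp: clifford_group_def carrier_FactGroup)
    then have "acts_by U T" using clifford_proj_class(2) proj[OF T] by metis
    then show ?thesis using U by (auto simp: acts_by_def implements_def normalizer_heisenberg)
  qed
  then obtain U l where U: "\<And>T. T \<in> carrier Sp_group \<Longrightarrow> U T \<in> normalizer unitary_group heisenberg"
    "\<And>T. T \<in> carrier Sp_group \<Longrightarrow> \<sigma> T = phase_class (U T)"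
    "\<And>T. T \<in> carrier Sp_group \<Longrightarrow> implements (U T) T (l T)" by metis
  have "l (S \<circ> T) u = l S (T u) * l T u"
    if ST: "S \<in> carrier Sp_group" "T \<in> carrier Sp_group" for S T u
  proof -
    have ST': "S \<circ> T \<in> carrier Sp_group"
      using monoid.m_closed[OF group.is_monoid[OF Sp_group_group] ST] by (simp add: Sp_group_def)
    have "phase_class (U (S \<circ> T)) = phase_class (U S ** U T)"
    proof -
      have "\<sigma> (S \<circ> T) = \<sigma> S \<otimes>\<^bsub>clifford_group\<^esub> \<sigma> T"
        using hom_mult[OF hom ST] by (simp add: Sp_group_def)
      then show ?thesis
        using phase_class_mult[OF U(1)[OF ST(1)] U(1)[OF ST(2)]] U(2)[OF ST'] U(2)[OF ST(1)] U(2)[OF ST(2)]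
        by simp
    qed
    then obtain z where z: "norm z = 1" "U (S \<circ> T) = mat z ** (U S ** U T)"
      using phase_class_eqD by blast
    have "mat (l (S \<circ> T) u) ** weyl (S (T u)) = mat (l S (T u) * l T u) ** weyl (S (T u))"
      using U(3)[OF ST'] implements_comp[OF U(3)[OF ST(1)] U(3)[OF ST(2)]]
      by (simp add: implements_def z conj_scal unit_cnj)
    moreover have "norm (l (S \<circ> T) u) = 1" using U(3)[OF ST'] by (simp add: implements_def)
    then have "l (S \<circ> T) u \<noteq> 0" by auto
    ultimately show ?thesis using weyl_proportional by blast
  qed
  moreover have "clifford_phase T (l T)" if T: "T \<in> carrier Sp_group" for T
    using implements_phase[OF U(3)[OF T] Sp_groupD(2)[OF T]] .
  ultimately show ?R by (intro exI[of _ l]) blast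
next
  assume ?R
  then obtain l where l: "\<And>T. T \<in> carrier Sp_group \<Longrightarrow> clifford_phase T (l T)"
    and comp: "\<And>S T u. S \<in> carrier Sp_group \<Longrightarrow> T \<in> carrier Sp_group \<Longrightarrow>
       l (S \<circ> T) u = l S (T u) * l T (u :: 'a phase_space)" by blast
  have "\<exists>U. implements U T (l T)" if T: "T \<in> carrier Sp_group" for T
    using implements_exists[OF Sp_groupD(2)[OF T] l[OF T]] .
  then obtain U where U: "\<And>T. T \<in> carrier Sp_group \<Longrightarrow> implements (U T) T (l T)" by metis
  have N: "U T \<in> normalizer unitary_group heisenberg" if T: "T \<in> carrier Sp_group" for T
    using implements_normalizer[OF U[OF T] Sp_groupD(1)[OF T]] .
  have "(\<lambda>T. phase_class (U T)) \<in> hom Sp_group clifford_group"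
  proof (rule homI)
    fix T :: "'a phase_space \<Rightarrow> 'a phase_space" assume "T \<in> carrier Sp_group"
    then show "phase_class (U T) \<in> carrier clifford_group"
      using N by (auto simp: clifford_group_def carrier_FactGroup)
  next
    fix S T :: "'a phase_space \<Rightarrow> 'a phase_space"
    assume ST: "S \<in> carrier Sp_group" "T \<in> carrier Sp_group"
    have ST': "S \<circ> T \<in> carrier Sp_group"
      using monoid.m_closed[OF group.is_monoid[OF Sp_group_group] ST] by (simp add: Sp_group_def)
    have "l (S \<circ> T) = (\<lambda>u. l S (T u) * l T u)" using comp ST by blast
    then have "implements (U S ** U T) (S \<circ> T) (l (S \<circ> T))"
      using implements_comp[OF U[OF ST(1)] U[OF ST(2)]] by simp
    from implements_unique[OF this U[OF ST']] have "phase_class (U (S \<circ> T)) = phase_class (U S ** U T)"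
      using phase_class_scal by metis
    then show "phase_class (U (S \<otimes>\<^bsub>Sp_group\<^esub> T)) = phase_class (U S) \<otimes>\<^bsub>clifford_group\<^esub> phase_class (U T)"
      using phase_class_mult[OF N[OF ST(1)] N[OF ST(2)]] by (simp add: Sp_group_def)
  qed
  moreover have "clifford_proj (phase_class (U T)) = T" if T: "T \<in> carrier Sp_group" for T
  proof (rule clifford_proj_eqI[OF N[OF T]])
    show "acts_by (U T) T" using U[OF T] unfolding acts_by_def implements_def by blast
  qed
  ultimately show ?L by (intro bexI[of _ "\<lambda>T. phase_class (U T)"]) auto
qed

section \<open>Obstruction from transvections\<close>

lemma Sp_groupI:
  assumes "bij T" "\<And>u v. T (u + v) = T u + T v" "\<And>u v. symp_form (T u) (T v) = symp_form u v"
  shows "T \<in> carrier Sp_group"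
  using assms by (simp add: Sp_group_def)

text \<open>Symmetry of \<open>\<theta>\<close> makes the two new factors in
  \<open>symp_form\<close> cancel.\<close>

lemma lower_shear_Sp_group:
  fixes \<theta> :: "'a::ab_group_add dual \<Rightarrow> 'a"
  assumes add: "\<And>c d. \<theta> (c + d) = \<theta> c + \<theta> d"
    and sym: "\<And>c d. dual_apply c (\<theta> d) = dual_apply d (\<theta> c)"
  shows "(\<lambda>u. (fst u + \<theta> (snd u), snd u)) \<in> carrier Sp_group"
proof (rule Sp_groupI)
  show "bij (\<lambda>u. (fst u + \<theta> (snd u), snd u))"
    by (rule bij_betwI[where g = "\<lambda>u. (fst u - \<theta> (snd u), snd u)"]) auto
qed (simp_all add: prod_eq_iff add symp_form_def dual_apply_add sym add_ac)

lemma upper_shear_Sp_group: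
  fixes \<phi> :: "'a::ab_group_add \<Rightarrow> 'a dual"
  assumes add: "\<And>a b. \<phi> (a + b) = \<phi> a + \<phi> b"
    and sym: "\<And>a b. dual_apply (\<phi> a) b = dual_apply (\<phi> b) a"
  shows "(\<lambda>u. (fst u, snd u + \<phi> (fst u))) \<in> carrier Sp_group"
proof (rule Sp_groupI)
  show "bij (\<lambda>u. (fst u, snd u + \<phi> (fst u)))"
    by (rule bij_betwI[where g = "\<lambda>u. (fst u, snd u - \<phi> (fst u))"]) auto
  fix u v :: "'a phase_space"
  show "symp_form (fst u, snd u + \<phi> (fst u)) (fst v, snd v + \<phi> (fst v)) = symp_form u v"
    using sym[of "fst u" "fst v"] by (simp add: symp_form_def)
qed (simp_all add: prod_eq_iff add add_ac)

lemma dual_apply_involution: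
  assumes "a + a = 0" shows "dual_apply c a = 1 \<or> dual_apply c a = -1"
  using dual_apply_add[of c a a] assms by (simp add: power2_eq_1_iff[symmetric] power2_eq_square)

text \<open>If 2h = 0, then c(h) is a sign, and this is the homomorphism to {0, h} that records
  it.\<close>

definition involution_part :: "'a::ab_group_add \<Rightarrow> 'a dual \<Rightarrow> 'a" where
  "involution_part h c = (if dual_apply c h = 1 then 0 else h)"

text \<open>A point is moved by (h, 0) exactly when its symplectic pairing with (h, 0) is not
  1.\<close>

definition transvection :: "'a::ab_group_add \<Rightarrow> 'a phase_space \<Rightarrow> 'a phase_space" where
  "transvection h u = (fst u + involution_part h (snd u), snd u)"

lemma transvection_Sp_group:
  assumes "h + h = 0" shows "transvection h \<in> carrier Sp_group"
  unfolding transvection_def[abs_def]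
proof (rule lower_shear_Sp_group)
  fix c d :: "'a dual"
  show "involution_part h (c + d) = involution_part h c + involution_part h d"
    using dual_apply_involution[OF assms, of c] dual_apply_involution[OF assms, of d] assms
    by (auto simp: involution_part_def)
  show "dual_apply c (involution_part h d) = dual_apply d (involution_part h c)"
    using dual_apply_involution[OF assms, of c] dual_apply_involution[OF assms, of d]
    by (auto simp: involution_part_def)
qed

lemma add_subgroup_doubles: "add_subgroup (range (\<lambda>k. k + k))"
  unfolding add_subgroup_def
proof (intro conjI ballI)
  show "0 \<in> range (\<lambda>k::'a. k + k)" by (rule range_eqI[of _ _ 0]) simp
  fix a b assume "a \<in> range (\<lambda>k::'a. k + k)" "b \<in> range (\<lambda>k::'a. k + k)"
  then obtain j k where "a = j + j" "b = k + k" by blast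
  then show "a - b \<in> range (\<lambda>k. k + k)" by (intro range_eqI[of _ _ "j - k"]) simp
qed

text \<open>The phase data of a splitting: assumed here to derive the obstruction, constructed in
  \<open>phases_exist\<close> for the converse.\<close>

locale phase_lift =
  fixes l :: "('a::{ab_group_add,finite} phase_space \<Rightarrow> 'a phase_space) \<Rightarrow> 'a phase_space \<Rightarrow> complex"
  assumes phase: "T \<in> carrier Sp_group \<Longrightarrow> clifford_phase T (l T)"
    and comp: "S \<in> carrier Sp_group \<Longrightarrow> T \<in> carrier Sp_group \<Longrightarrow> l (S \<circ> T) u = l S (T u) * l T u"
begin

lemma phase_nz: "T \<in> carrier Sp_group \<Longrightarrow> l T u \<noteq> 0"
  using phase by (metis clifford_phase_def norm_zero zero_neq_one)

lemma phase_id: "l id u = 1"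
proof -
  have "id \<in> carrier (Sp_group :: ('a phase_space \<Rightarrow> 'a phase_space) monoid)"
    by (rule Sp_groupI) auto
  then show ?thesis using comp[of id id u] phase_nz[of id u] by simp
qed

text \<open>Expanding both orders of composition at the fixed point \<open>u\<close> leaves the
  nonzero factor \<open>l S u\<close> to cancel.\<close>

lemma phase_commute:
  assumes "S \<in> carrier Sp_group" "T \<in> carrier Sp_group" "S \<circ> T = T \<circ> S" "T u = u"
  shows "l T (S u) = l T u"
  using comp[OF assms(1,2), of u] comp[OF assms(2,1), of u] assms(3,4) phase_nz[OF assms(1), of u]
  by simp

context
  fixes h :: 'a
  assumes h: "h + h = 0"
begin

abbreviation "h_phase \<equiv> l (transvection h)"

text \<open>The sign appears only if both points are moved: then the cocycle of the images gains the
  factor \<open>dual_apply (snd u) h\<close>, which is -1.\<close>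

lemma transvection_phase_add:
  "h_phase (u + v) = h_phase u * h_phase v * (if dual_apply (snd u) h = 1 \<or> dual_apply (snd v) h = 1 then 1 else -1)"
proof -
  have "h_phase u * h_phase v * weyl_cocycle (transvection h u) (transvection h v) = weyl_cocycle u v * h_phase (u + v)"
    using phase[OF transvection_Sp_group[OF h]] by (simp add: clifford_phase_def)
  moreover have "weyl_cocycle (transvection h u) (transvection h v)
      = weyl_cocycle u v * (if dual_apply (snd u) h = 1 \<or> dual_apply (snd v) h = 1 then 1 else -1)"
    using dual_apply_involution[OF h, of "snd u"]
    by (auto simp: transvection_def involution_part_def dual_apply_add)
  ultimately show ?thesis by (auto split: if_splits)
qed

lemma transvection_phase_fixed:
  assumes "dual_apply (snd u) h = 1" shows "h_phase u * h_phase u = 1"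
proof -
  have "transvection h \<circ> transvection h = id"
    using h by (auto simp: fun_eq_iff transvection_def involution_part_def add.assoc)
  then have "h_phase (transvection h u) * h_phase u = 1"
    using comp[OF transvection_Sp_group[OF h] transvection_Sp_group[OF h], of u] phase_id by simp
  then show ?thesis using assms by (simp add: transvection_def involution_part_def)
qed

text \<open>The transvection squares to the identity and sends this \<open>u\<close> to
  \<open>u + (h, 0)\<close>.\<close>

lemma transvection_phase_moved:
  assumes "dual_apply (snd u) h \<noteq> 1" shows "h_phase u * h_phase u * h_phase (h, 0) = 1"
proof -
  have "transvection h \<circ> transvection h = id"
    using h by (auto simp: fun_eq_iff transvection_def involution_part_def add.assoc)
  then have "h_phase (transvection h u) * h_phase u = 1"
    using comp[OF transvection_Sp_group[OF h] transvection_Sp_group[OF h], of u] phase_id by simp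
  moreover have "transvection h u = u + (h, 0)"
    using assms by (simp add: transvection_def involution_part_def prod_eq_iff)
  ultimately show ?thesis using transvection_phase_add[of u "(h, 0)"] by (simp add: mult_ac)
qed

text \<open>A character with value -1 at \<open>h\<close> yields a shear commuting with the
  transvection. Invariance under it forces the phase -1 at (h, 0), while halving \<open>h\<close>
  forces 1.\<close>

lemma no_lift_divisible_involution:
  assumes "h \<noteq> 0" "h = k + k"
  shows False
proof -
  obtain c where "dual_apply c h \<noteq> dual_apply c 0" using dual_separates_points[OF \<open>h \<noteq> 0\<close>] by blast
  then have ch: "dual_apply c h = -1" using dual_apply_involution[OF h, of c] by auto
  define N where "N = (LEAST N. 0 < N \<and> nmul N c = 0)"
  have "nmul (CARD('a)) c = 0" by (rule dual_eqI) (simp add: dual_nmul_apply dual_apply_pow_card)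
  then have N: "0 < N" "nmul N c = 0"
    unfolding N_def using LeastI[of "\<lambda>N. 0 < N \<and> nmul N c = 0" "CARD('a)"] by auto
  have least: "\<not> (0 < r \<and> nmul r c = 0)" if "r < N" for r
    using that unfolding N_def by (rule not_less_Least)
  have cN: "dual_apply c a ^ N = 1" for a
    using dual_nmul_apply[of N c a] N(2) by simp
  have "even N" using cN[of h] ch by (metis neg_one_odd_power one_neq_neg_one)
  define e where "e j = exp (2 * of_real pi * \<i> * of_nat j / of_nat N)" for j
  define \<zeta> where "\<zeta> = e 1"
  have e: "e j = \<zeta> ^ j" for j
    by (simp add: \<zeta>_def e_def exp_of_nat_mult[symmetric] field_simps)
  have e_inj: "i mod N = j mod N" if "\<zeta> ^ i = \<zeta> ^ j" for i j
  proof -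
    have "e i = e j" using that e by metis
    then show ?thesis unfolding e_def using complex_root_unity_eq[of N i j] N(1) by simp
  qed
  have "e N = 1" using N(1) by (simp add: e_def)
  then have eN: "\<zeta> ^ N = 1" using e by metis
  have nmul_mod: "nmul (j mod N) c = nmul j c" for j
  proof -
    have "nmul j c = nmul (j mod N) c + nmul (j div N) (nmul N c)"
      by (simp add: nmul_nmul nmul_plus[symmetric])
    then show ?thesis using N(2) by simp
  qed
  have "\<exists>j. dual_apply c a = \<zeta> ^ j" for a
  proof -
    have "dual_apply c a \<in> {z. z ^ N = 1}" using cN by simp
    then obtain j where "dual_apply c a = e j"
      unfolding e_def using complex_roots_unity[of N] N(1) by auto
    then show ?thesis using e by metis
  qed
  then obtain x where x: "\<And>a. dual_apply c a = \<zeta> ^ x a" by metis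
  \<comment> \<open>The pairing of \<open>a\<close> and \<open>b\<close> becomes
    \<open>\<zeta>\<close> to the power 2 x(a) x(b), which is symmetric. The factor 2 puts
    \<open>h\<close> into its radical, so the shear commutes with the transvection.\<close>
  define \<phi> where "\<phi> a = nmul (2 * x a) c" for a
  have \<phi>_add: "\<phi> (a + b) = \<phi> a + \<phi> b" for a b
  proof -
    have "\<zeta> ^ x (a + b) = \<zeta> ^ (x a + x b)" unfolding power_add x[symmetric] by (rule dual_apply_add)
    then have "(2 * x (a + b)) mod N = (2 * (x a + x b)) mod N" using e_inj by (metis mod_mult_right_eq)
    then have "\<phi> (a + b) = nmul (2 * (x a + x b)) c" unfolding \<phi>_def using nmul_mod by metis
    then show ?thesis by (simp add: \<phi>_def nmul_plus distrib_left)
  qed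
  have \<phi>_sym: "dual_apply (\<phi> a) b = dual_apply (\<phi> b) a" for a b
    by (simp add: \<phi>_def dual_nmul_apply x power_mult[symmetric] mult_ac)
  have \<phi>_h: "\<phi> h = 0"
  proof -
    have "\<zeta> ^ (2 * x h) = 1" unfolding mult.commute[of 2] power_mult x[symmetric] ch by simp
    then have "\<zeta> ^ (2 * x h) = \<zeta> ^ 0" by simp
    from e_inj[OF this] show ?thesis unfolding \<phi>_def using nmul_mod[of "2 * x h"] by simp
  qed
  have \<phi>h: "dual_apply (\<phi> a) h = 1" for a using \<phi>_sym[of a h] \<phi>_h by simp
  let ?S = "\<lambda>u. (fst u, snd u + \<phi> (fst u))"
  have S: "?S \<in> carrier Sp_group" by (rule upper_shear_Sp_group) (fact \<phi>_add, fact \<phi>_sym)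
  have S_comm: "?S \<circ> transvection h = transvection h \<circ> ?S"
    using \<phi>_add \<phi>_add[of 0 0] \<phi>_h \<phi>h by (auto simp: fun_eq_iff transvection_def involution_part_def)
  \<comment> \<open>If all exponents were even, N/2 would already annihilate \<open>c\<close>,
    against the minimality of \<open>N\<close>.\<close>
  obtain a where a: "odd (x a)"
  proof -
    have "\<exists>a. odd (x a)"
    proof (rule ccontr)
      assume "\<not> ?thesis"
      then have ev: "even (x a)" for a by blast
      have "nmul (N div 2) c = 0"
      proof (rule dual_eqI)
        fix a
        have "x a * (N div 2) = N * (x a div 2)" using ev[of a] \<open>even N\<close> by auto
        then show "dual_apply (nmul (N div 2) c) a = dual_apply 0 a"
          by (simp add: dual_nmul_apply x power_mult[symmetric]) (simp add: power_mult eN)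
      qed
      moreover have "0 < N div 2" "N div 2 < N" using N(1) \<open>even N\<close> by auto
      ultimately show False using least by blast
    qed
    then show ?thesis using that by blast
  qed
  \<comment> \<open>Half of \<open>\<phi> a\<close>, yet nontrivial at \<open>h\<close> because
    \<open>x a\<close> is odd.\<close>
  define d where "d = nmul (x a) c"
  have dh: "dual_apply d h = -1" using ch a by (simp add: d_def dual_nmul_apply)
  have dd: "\<phi> a = d + d" by (simp add: \<phi>_def d_def mult_2 nmul_plus)
  have "transvection h (a, 0) = (a, 0)" by (simp add: transvection_def involution_part_def)
  from phase_commute[OF S transvection_Sp_group[OF h] S_comm this]
  have "h_phase (a, \<phi> a) = h_phase (a, 0)" by simp
  moreover have "h_phase (a, \<phi> a) = h_phase (a, 0) * h_phase (0, \<phi> a)"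
    using transvection_phase_add[of "(a, 0)" "(0, \<phi> a)"] by simp
  ultimately have "h_phase (0, \<phi> a) = 1" using phase_nz[OF transvection_Sp_group[OF h], of "(a, 0)"] by simp
  moreover have "h_phase (0, \<phi> a) = - (h_phase (0, d) * h_phase (0, d))"
    using transvection_phase_add[of "(0, d)" "(0, d)"] dh by (simp add: dd)
  ultimately have "h_phase (0, d) * h_phase (0, d) = -1" by (metis minus_minus)
  then have "- h_phase (h, 0) = 1" using transvection_phase_moved[of "(0, d)"] dh by simp
  then have "h_phase (h, 0) = -1" by (metis minus_minus)
  moreover have "h_phase (h, 0) = 1"
    using transvection_phase_add[of "(k, 0)" "(k, 0)"] transvection_phase_fixed[of "(k, 0)"] assms(2) by simp
  ultimately show False by simp
qed

text \<open>Involutions other than \<open>h\<close> have phase 1; comparing \<open>g\<close> with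
  \<open>g + h\<close> gives phase 1 at \<open>h\<close> too. A character of order two that is
  nontrivial at \<open>h\<close> contradicts this.\<close>

lemma no_lift_two_involutions:
  assumes "h \<noteq> 0" "\<And>k. h \<noteq> k + k" "g + g = 0" "g \<noteq> 0" "g \<noteq> h"
  shows False
proof -
  have q1: "h_phase (g, 0) = 1" if g: "g + g = 0" "g \<noteq> 0" "g \<noteq> h" for g
  proof -
    \<comment> \<open>The character must be trivial at \<open>h\<close>, so that (0, c) is fixed,
      and nontrivial at \<open>g\<close>, so that \<open>transvection g\<close> moves it.\<close>
    have "add_subgroup {0, h}" using h by (auto simp: add_subgroup_def minus_unique[OF h])
    from dual_separates[OF this, of g] g obtain c
      where c: "dual_apply c h = 1" "dual_apply c g \<noteq> 1" by auto
    have "transvection g \<circ> transvection h = transvection h \<circ> transvection g"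
      by (auto simp: fun_eq_iff transvection_def add_ac)
    moreover have "transvection h (0, c) = (0, c)" using c by (simp add: transvection_def involution_part_def)
    ultimately have "h_phase (g, c) = h_phase (0, c)"
      using phase_commute[OF transvection_Sp_group[OF g(1)] transvection_Sp_group[OF h], of "(0, c)"] c
      by (simp add: transvection_def involution_part_def)
    moreover have "h_phase (g, c) = h_phase (g, 0) * h_phase (0, c)"
      using transvection_phase_add[of "(g, 0)" "(0, c)"] by simp
    ultimately show ?thesis using phase_nz[OF transvection_Sp_group[OF h], of "(0, c)"] by simp
  qed
  have "g + h + (g + h) = 0" using assms(3) h by (metis add.left_commute add.assoc add_0_right)
  moreover have "g + h \<noteq> 0" using h assms(5) by (metis add.commute add_left_imp_eq)
  ultimately have "h_phase (g + h, 0) = 1" using q1[of "g + h"] assms(4) by simp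
  moreover have "h_phase (g + h, 0) = h_phase (g, 0) * h_phase (h, 0)"
    using transvection_phase_add[of "(g, 0)" "(h, 0)"] by simp
  ultimately have qh: "h_phase (h, 0) = 1" using q1[OF assms(3-5)] by simp
  have "add_subgroup (range (\<lambda>k. k + k))"
    by (rule add_subgroup_doubles)
  moreover have "h \<notin> range (\<lambda>k. k + k)" using assms(2) by auto
  ultimately obtain c where c: "\<forall>k\<in>range (\<lambda>k. k + k). dual_apply c k = 1" "dual_apply c h \<noteq> 1"
    using dual_separates by blast
  have "c + c = 0"
    using c(1) by (intro dual_eqI) (simp add: dual_apply_add)
  then have "h_phase (0, 0) = - (h_phase (0, c) * h_phase (0, c))"
    using transvection_phase_add[of "(0, c)" "(0, c)"] c(2) by simp
  moreover have "h_phase (0, 0) = 1"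
    using transvection_phase_add[of 0 0] phase_nz[OF transvection_Sp_group[OF h], of 0]
    by (simp add: zero_prod_def)
  moreover have "h_phase (0, c) * h_phase (0, c) = 1" using transvection_phase_moved[of "(0, c)"] c(2) qh by simp
  ultimately show False by simp
qed

end

text \<open>The two cases above leave a single involution \<open>h\<close>, which is not a double.
  Hence the doubles have odd order, and since doubling has kernel {0, h}, the order of the group is
  twice an odd number.\<close>

lemma not_4_dvd_card: "\<not> 4 dvd CARD('a)"
proof
  assume 4: "4 dvd CARD('a)"
  have UNIV: "add_subgroup (UNIV :: 'a set)" by (simp add: add_subgroup_def)
  have "even (CARD('a))" using 4 by auto
  then obtain h :: 'a where h: "h \<noteq> 0" "h + h = 0" using even_card_subgroup_iff[OF UNIV] by blast
  have h2: "h \<noteq> k + k" for k using no_lift_divisible_involution[OF h(2,1)] by blast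
  have inv: "g = 0 \<or> g = h" if "g + g = 0" for g
    using no_lift_two_involutions[OF h(2,1) h2 that] by blast
  let ?D = "range (\<lambda>k::'a. k + k)"
  have D: "add_subgroup ?D"
    by (rule add_subgroup_doubles)
  have "\<not> even (card ?D)"
    unfolding even_card_subgroup_iff[OF D] using inv h2 by blast
  moreover have "CARD('a) = card {0, h} * card ?D"
  proof (rule card_hom_image)
    fix a b :: 'a
    have "a + a = b + b \<longleftrightarrow> (a - b) + (a - b) = 0" by (simp add: algebra_simps)
    then show "a + a = b + b \<longleftrightarrow> a - b \<in> {0, h}" using inv[of "a - b"] h by auto
  qed
  then have "CARD('a) = 2 * card ?D" using h by simp
  ultimately show False using 4 by auto
qed

end

section \<open>Lifts when four does not divide the order\<close>

lemma symp_form_cocycle: "symp_form u v = weyl_cocycle u v / weyl_cocycle v u"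
  by (simp add: symp_form_def divide_inverse)

lemma symp_form_add: "symp_form (u + v) w = symp_form u w * symp_form v w"
    "symp_form u (v + w) = symp_form u v * symp_form u w"
  by (simp_all add: symp_form_def dual_apply_add)

text \<open>The points killed by 2 form a nondegenerate plane over the field with two elements, or
  zero; allowing \<open>x = y = 0\<close> covers odd order at the same time.\<close>

locale involution_plane =
  fixes x y :: "'a::{ab_group_add,finite} phase_space"
  assumes involutions: "q + q = 0 \<Longrightarrow> q \<in> {0, x, y, x + y}"
    and xx: "x + x = 0" and yy: "y + y = 0"
    and xy: "(x = 0 \<and> y = 0) \<or> symp_form x y = -1"
begin

text \<open>If q + q = 0, this is a square root of \<open>weyl_cocycle q q\<close>, so
  \<open>mat (half_phase q) ** weyl q\<close> squares to the identity, like a Pauli matrix.\<close>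

definition half_phase :: "'a phase_space \<Rightarrow> complex" where
  "half_phase q = (if weyl_cocycle q q = 1 then 1 else \<i>)"

text \<open>The cocycle of these rescaled operators; on distinct involutions it takes the values i
  and -i.\<close>

definition sign_cocycle :: "'a phase_space \<Rightarrow> 'a phase_space \<Rightarrow> complex" where
  "sign_cocycle q r = half_phase q * half_phase r * weyl_cocycle q r / half_phase (q + r)"

lemma half_phase_nz [simp]: "half_phase q \<noteq> 0" and half_phase_0 [simp]: "half_phase 0 = 1" and norm_half_phase [simp]: "norm (half_phase q) = 1"
  by (simp_all add: half_phase_def)

lemma cocycle_involution:
  assumes "q + q = 0"
  shows "weyl_cocycle q r = 1 \<or> weyl_cocycle q r = -1" "weyl_cocycle r q = 1 \<or> weyl_cocycle r q = -1"
proof -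
  have "weyl_cocycle (q + q) r = 1" "weyl_cocycle r (q + q) = 1" unfolding assms by simp_all
  then show "weyl_cocycle q r = 1 \<or> weyl_cocycle q r = -1" "weyl_cocycle r q = 1 \<or> weyl_cocycle r q = -1"
    by (simp_all add: dual_apply_add power2_eq_1_iff[symmetric] power2_eq_square)
qed

lemma half_phase_square: "q + q = 0 \<Longrightarrow> half_phase q * half_phase q = weyl_cocycle q q"
  using cocycle_involution(1)[of q q] by (auto simp: half_phase_def)

definition distinct_involutions :: "'a phase_space \<Rightarrow> 'a phase_space \<Rightarrow> bool" where
  "distinct_involutions q r \<longleftrightarrow> q + q = 0 \<and> r + r = 0 \<and> q \<noteq> 0 \<and> r \<noteq> 0 \<and> q \<noteq> r"

lemma symp_form_distinct:
  assumes "distinct_involutions q r" shows "symp_form q r = -1"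
proof -
  have nz: "\<not> (x = 0 \<and> y = 0)" and q: "q \<in> {x, y, x + y}" and r: "r \<in> {x, y, x + y}" and "q \<noteq> r"
    using assms involutions[of q] involutions[of r] by (auto simp: distinct_involutions_def)
  have "symp_form x y = -1" using xy nz by blast
  moreover have "symp_form x x = 1" "symp_form y y = 1" by (simp_all add: symp_form_def)
  moreover have "symp_form y x = inverse (symp_form x y)" by (simp add: symp_form_def)
  ultimately show ?thesis using q r \<open>q \<noteq> r\<close> by (auto simp: symp_form_add)
qed

lemma cocycle_swap:
  assumes "distinct_involutions q r" shows "weyl_cocycle r q = - weyl_cocycle q r"
  using symp_form_distinct[OF assms] by (simp add: symp_form_cocycle field_simps minus_equation_iff)

lemma sign_cocycle_swap:
  assumes "distinct_involutions q r" shows "sign_cocycle r q = - sign_cocycle q r"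
  by (simp add: sign_cocycle_def cocycle_swap[OF assms] add.commute mult_ac)

lemma distinct_involutions_rotate:
  assumes "distinct_involutions q r" shows "distinct_involutions r (q + r)"
proof -
  have qr: "q + q = 0" "r + r = 0" "q \<noteq> 0" "r \<noteq> 0" "q \<noteq> r"
    using assms by (auto simp: distinct_involutions_def)
  have "q + r + (q + r) = (q + q) + (r + r)" by (simp only: add_ac)
  moreover have "q + r \<noteq> 0" using qr(2,5) by (metis add_right_cancel)
  ultimately show ?thesis using qr by (simp add: distinct_involutions_def)
qed

lemma cocycle_sum_self:
  "weyl_cocycle (q + r) (q + r) = weyl_cocycle q q * weyl_cocycle q r * weyl_cocycle r q * weyl_cocycle r r"
  by (simp add: dual_apply_add mult_ac)

text \<open>The analogue of passing from XY = iZ to YZ = iX. With \<open>sign_cocycle_swap\<close>,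
  only the cyclic order of the three involutions matters.\<close>

lemma sign_cocycle_rotate:
  assumes "distinct_involutions q r" shows "sign_cocycle r (q + r) = sign_cocycle q r"
proof -
  have qr: "q + q = 0" "r + r = 0" "q + r + (q + r) = 0" "r + (q + r) = q"
    using assms distinct_involutions_rotate[OF assms] unfolding distinct_involutions_def
    by (auto simp: add.left_commute[of r q r])
  have sq: "weyl_cocycle q q * weyl_cocycle q q = 1" "weyl_cocycle r r * weyl_cocycle r r = 1"
    using cocycle_involution(1)[OF qr(1), of q] cocycle_involution(1)[OF qr(2), of r] by auto
  have s: "half_phase (q + r) * half_phase (q + r) = - (weyl_cocycle q q * weyl_cocycle q r * weyl_cocycle q r * weyl_cocycle r r)"
    using half_phase_square[OF qr(3)] cocycle_swap[OF assms] unfolding cocycle_sum_self by simp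
  have "weyl_cocycle r (q + r) = weyl_cocycle r q * weyl_cocycle r r" by (simp add: dual_apply_add)
  then have c: "weyl_cocycle r (q + r) = - weyl_cocycle q r * weyl_cocycle r r"
    using cocycle_swap[OF assms] by simp
  have q1: "weyl_cocycle q r * weyl_cocycle q r = 1"
    using cocycle_involution(1)[OF qr(1), of r] by auto
  have "(half_phase r * half_phase (q + r) * weyl_cocycle r (q + r)) * half_phase (q + r)
      = half_phase r * weyl_cocycle r (q + r) * (half_phase (q + r) * half_phase (q + r))" by (simp only: mult_ac)
  also have "\<dots> = (weyl_cocycle r r * weyl_cocycle r r) * (weyl_cocycle q r * weyl_cocycle q r)
      * half_phase r * weyl_cocycle q q * weyl_cocycle q r" by (simp only: s c) (simp add: mult_ac)
  also have "\<dots> = (half_phase q * half_phase r * weyl_cocycle q r) * half_phase q"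
    using half_phase_square[OF qr(1)] by (simp only: sq q1) (simp add: mult_ac)
  finally show ?thesis by (simp add: sign_cocycle_def qr(4) frac_eq_eq)
qed

lemma sign_cocycle_square:
  assumes "distinct_involutions q r" shows "sign_cocycle q r * sign_cocycle q r = -1"
proof -
  have qr: "q + q = 0" "r + r = 0" "q + r + (q + r) = 0"
    using assms distinct_involutions_rotate[OF assms] unfolding distinct_involutions_def by auto
  have s: "half_phase (q + r) * half_phase (q + r) = - (weyl_cocycle q q * weyl_cocycle q r * weyl_cocycle q r * weyl_cocycle r r)"
    using half_phase_square[OF qr(3)] cocycle_swap[OF assms] unfolding cocycle_sum_self by simp
  have "sign_cocycle q r * sign_cocycle q r = (half_phase q * half_phase q) * (half_phase r * half_phase r)
      * (weyl_cocycle q r * weyl_cocycle q r) / (half_phase (q + r) * half_phase (q + r))"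
    by (simp add: sign_cocycle_def)
  then show ?thesis unfolding s half_phase_square[OF qr(1)] half_phase_square[OF qr(2)] by simp
qed

lemma sign_cocycle_trivial: "sign_cocycle 0 r = 1" "sign_cocycle r 0 = 1"
  by (simp_all add: sign_cocycle_def)

lemma sign_cocycle_self:
  assumes "q + q = 0" shows "sign_cocycle q q = 1"
  using cocycle_involution(1)[OF assms, of q] assms
  by (auto simp: sign_cocycle_def half_phase_square[OF assms])

lemma distinct_involutions_Sp:
  assumes T: "T \<in> carrier Sp_group" and "distinct_involutions q r"
  shows "distinct_involutions (T q) (T r)"
proof -
  have inj: "T u = T v \<longleftrightarrow> u = v" for u v using Sp_groupD(1)[OF T] by (meson bij_is_inj inj_eq)
  have "T u + T u = T (u + u)" for u by (simp only: Sp_groupD(2)[OF T])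
  then show ?thesis
    using assms(2) inj[of q 0] inj[of r 0] inj[of q r] unfolding distinct_involutions_def
    by (simp add: Sp_groupD(4)[OF T])
qed

text \<open>The sign of the permutation that \<open>T\<close> induces on the three involutions of the plane.\<close>

definition orientation :: "('a phase_space \<Rightarrow> 'a phase_space) \<Rightarrow> complex" where
  "orientation T = sign_cocycle (T x) (T y) / sign_cocycle x y"

lemma distinct_xy: "\<not> (x = 0 \<and> y = 0) \<Longrightarrow> distinct_involutions x y"
  using xx yy xy unfolding distinct_involutions_def by (auto simp: symp_form_def)

lemma sign_cocycle_nz: "sign_cocycle q r \<noteq> 0"
  by (simp add: sign_cocycle_def)

text \<open>Swaps and rotations reach all six ordered pairs from (x, y), and both preserve the ratio
  that defines \<open>orientation T\<close>.\<close>

lemma orientation_works: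
  assumes T: "T \<in> carrier Sp_group" and qr: "distinct_involutions q r"
  shows "sign_cocycle (T q) (T r) = orientation T * sign_cocycle q r"
proof -
  define R where "R q r \<longleftrightarrow> sign_cocycle (T q) (T r) = orientation T * sign_cocycle q r" for q r
  have swap: "R r q" if "distinct_involutions q r" "R q r" for q r
    using that sign_cocycle_swap[OF that(1)] sign_cocycle_swap[OF distinct_involutions_Sp[OF T that(1)]]
    by (simp add: R_def)
  have rot: "R r (q + r)" if "distinct_involutions q r" "R q r" for q r
    using that sign_cocycle_rotate[OF that(1)] sign_cocycle_rotate[OF distinct_involutions_Sp[OF T that(1)]]
    by (simp add: R_def Sp_groupD(2)[OF T])
  have q: "q \<in> {x, y, x + y}" and r: "r \<in> {x, y, x + y}" and "q \<noteq> r" and "\<not> (x = 0 \<and> y = 0)"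
    using qr involutions[of q] involutions[of r] by (auto simp: distinct_involutions_def)
  have d1: "distinct_involutions x y" using distinct_xy \<open>\<not> (x = 0 \<and> y = 0)\<close> by blast
  have d2: "distinct_involutions y (x + y)" using distinct_involutions_rotate[OF d1] .
  have e: "y + (x + y) = x" using yy by (simp add: add.left_commute)
  have d3: "distinct_involutions (x + y) x" using distinct_involutions_rotate[OF d2] e by simp
  have r1: "R x y" by (simp add: R_def orientation_def sign_cocycle_nz)
  have r2: "R y (x + y)" using rot[OF d1 r1] .
  have r3: "R (x + y) x" using rot[OF d2 r2] e by simp
  have "R q r"
    using q r \<open>q \<noteq> r\<close> r1 r2 r3 swap[OF d1 r1] swap[OF d2 r2] swap[OF d3 r3] by auto
  then show ?thesis by (simp add: R_def)
qed

lemma orientation_square: 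
  assumes T: "T \<in> carrier Sp_group" shows "orientation T * orientation T = 1"
proof (cases "x = 0 \<and> y = 0")
  case True
  then have "orientation T = 1" unfolding orientation_def
    by (auto simp: Sp_groupD(4)[OF T] sign_cocycle_trivial)
  then show ?thesis by simp
next
  case False
  note d = distinct_xy[OF False]
  show ?thesis
    using sign_cocycle_square[OF d] sign_cocycle_square[OF distinct_involutions_Sp[OF T d]]
    by (simp add: orientation_def)
qed

lemma orientation_comp:
  assumes S: "S \<in> carrier Sp_group" and T: "T \<in> carrier Sp_group"
  shows "orientation (S \<circ> T) = orientation S * orientation T"
proof (cases "x = 0 \<and> y = 0")
  case True
  then show ?thesis unfolding orientation_def
    by (auto simp: Sp_groupD(4)[OF T] Sp_groupD(4)[OF S] sign_cocycle_trivial)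
next
  case False
  show ?thesis
    using orientation_works[OF S distinct_involutions_Sp[OF T distinct_xy[OF False]]]
    by (simp add: orientation_def)
qed

text \<open>For nonzero \<open>q\<close>, the rescaled operator at \<open>q\<close> goes to
  \<open>orientation T\<close> times the one at \<open>T q\<close>; the quotient of half phases
  converts back to \<open>weyl\<close>.\<close>

definition plane_phase :: "('a phase_space \<Rightarrow> 'a phase_space) \<Rightarrow> 'a phase_space \<Rightarrow> complex" where
  "plane_phase T q = (if q = 0 then 1 else orientation T) * half_phase (T q) / half_phase q"

lemma norm_plane_phase:
  assumes "T \<in> carrier Sp_group" shows "norm (plane_phase T q) = 1"
proof -
  have "orientation T = 1 \<or> orientation T = -1"
    using orientation_square[OF assms] by (simp add: power2_eq_1_iff[symmetric] power2_eq_square)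
  then show ?thesis by (auto simp: plane_phase_def norm_mult norm_divide)
qed

lemma Sp_eq_0_iff: "T \<in> carrier Sp_group \<Longrightarrow> T q = 0 \<longleftrightarrow> q = 0"
  by (metis Sp_groupD(1,4) bij_is_inj inj_eq)

lemma plane_phase_comp:
  assumes "S \<in> carrier Sp_group" "T \<in> carrier Sp_group"
  shows "plane_phase (S \<circ> T) q = plane_phase S (T q) * plane_phase T q"
  by (simp add: plane_phase_def orientation_comp[OF assms] Sp_eq_0_iff[OF assms(2)])

lemma plane_phase_cocycle:
  assumes T: "T \<in> carrier Sp_group" and q: "q + q = 0" and r: "r + r = 0"
  shows "plane_phase T q * plane_phase T r * weyl_cocycle (T q) (T r)
    = weyl_cocycle q r * plane_phase T (q + r)"
proof -
  define s where "s q = (if q = 0 then 1 else orientation T)" for q :: "'a phase_space"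
  have Tq: "T q + T q = 0" using q Sp_groupD(2)[OF T, of q q] Sp_groupD(4)[OF T] by simp
  have s2: "s q * s q = 1" for q using orientation_square[OF T] by (simp add: s_def)
  \<comment> \<open>For distinct involutions the two signs on the left cancel, and
    \<open>orientation_works\<close> supplies the one on the right. The other cases are
    degenerate.\<close>
  have key: "s q * s r * sign_cocycle (T q) (T r) = s (q + r) * sign_cocycle q r"
  proof -
    consider "q = 0" | "r = 0" | "q = r" | "distinct_involutions q r"
      using q r by (auto simp: distinct_involutions_def)
    then show ?thesis
    proof cases
      case 1 then show ?thesis by (simp add: s_def Sp_groupD(4)[OF T] sign_cocycle_trivial)
    next
      case 2 then show ?thesis by (simp add: s_def Sp_groupD(4)[OF T] sign_cocycle_trivial)
    next
      case 3
      then have "sign_cocycle q r = 1" "sign_cocycle (T q) (T r) = 1" "s (q + r) = 1"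
        using sign_cocycle_self[OF q] sign_cocycle_self[OF Tq] q by (simp_all add: s_def)
      then show ?thesis using s2[of q] 3 by simp
    next
      case 4
      have "q + r \<noteq> 0" "q \<noteq> 0" "r \<noteq> 0"
        using 4 distinct_involutions_rotate[OF 4] by (auto simp: distinct_involutions_def)
      then have "s (q + r) = orientation T" "s q = orientation T" "s r = orientation T"
        by (simp_all only: s_def if_False)
      then show ?thesis using orientation_square[OF T] orientation_works[OF T 4] by simp
    qed
  qed
  have 1: "half_phase (T q) * half_phase (T r) * weyl_cocycle (T q) (T r) = sign_cocycle (T q) (T r) * half_phase (T (q + r))"
    by (simp add: sign_cocycle_def Sp_groupD(2)[OF T])
  have 2: "weyl_cocycle q r = sign_cocycle q r * half_phase (q + r) / (half_phase q * half_phase r)"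
    by (simp add: sign_cocycle_def)
  have "plane_phase T q * plane_phase T r * weyl_cocycle (T q) (T r)
      = s q * s r * (half_phase (T q) * half_phase (T r) * weyl_cocycle (T q) (T r)) / (half_phase q * half_phase r)"
    by (simp add: plane_phase_def s_def)
  also have "\<dots> = (s q * s r * sign_cocycle (T q) (T r)) * half_phase (T (q + r)) / (half_phase q * half_phase r)"
    unfolding 1 by (simp only: mult_ac)
  also have "\<dots> = weyl_cocycle q r * plane_phase T (q + r)"
    unfolding key 2 by (simp add: plane_phase_def s_def)
  finally show ?thesis .
qed

lemma phases_exist:
  assumes m: "odd m" and ann: "\<And>u :: 'a phase_space. nmul (2 * m) u = 0"
  shows "\<exists>l. phase_lift (l :: ('a phase_space \<Rightarrow> 'a phase_space) \<Rightarrow> _)"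
proof -
  \<comment> \<open>\<open>e\<close> inverts 2 modulo the odd number \<open>m\<close>, so the
    \<open>e\<close>-th power is a square root on the odd part. In \<open>l\<close> below,
    \<open>nmul m\<close> projects to the points killed by 2, where \<open>plane_phase\<close>
    applies.\<close>
  define e where "e = (m + 1) div 2"
  have e: "2 * e = m + 1" using m by (simp add: e_def)
  define l where "l T u = (weyl_cocycle (T u) (T u) / weyl_cocycle u u) ^ e * plane_phase T (nmul m u)"
    for T and u :: "'a phase_space"
  \<comment> \<open>\<open>2 e\<close> and \<open>m\<^sup>2\<close> are the complementary idempotents modulo \<open>2 m\<close>.\<close>
  have split: "weyl_cocycle u v = (weyl_cocycle u v) ^ (2 * e) * weyl_cocycle (nmul m u) (nmul m v)"
    for u v :: "'a phase_space"
  proof -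
    have "snd (nmul (2 * m) u) = 0" using ann[of u] by simp
    then have 1: "weyl_cocycle u v ^ (2 * m) = 1"
      by (metis snd_nmul dual_nmul_apply dual_apply_zero)
    have "m * m + 2 * e = 2 * m * e + 1"
    proof -
      have "2 * m * e = m * (2 * e)" by simp
      also have "\<dots> = m * m + m" unfolding e by simp
      finally show ?thesis using e by simp
    qed
    then have "weyl_cocycle u v ^ (m * m + 2 * e) = (weyl_cocycle u v ^ (2 * m)) ^ e * weyl_cocycle u v"
      by (simp add: power_mult[symmetric])
    then have "weyl_cocycle u v = weyl_cocycle u v ^ (2 * e) * weyl_cocycle u v ^ (m * m)"
      unfolding 1 by (simp add: power_add mult.commute)
    moreover have "weyl_cocycle (nmul m u) (nmul m v) = weyl_cocycle u v ^ (m * m)"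
      by (simp add: snd_nmul fst_nmul dual_nmul_apply dual_apply_nmul power_mult)
    ultimately show ?thesis by simp
  qed
  have nm: "nmul m u + nmul m u = 0" for u :: "'a phase_space"
    using ann[of u] by (simp add: mult_2 nmul_plus)
  have "phase_lift l"
  proof
    fix T :: "'a phase_space \<Rightarrow> 'a phase_space" assume T: "T \<in> carrier Sp_group"
    have Tm: "T (nmul m u) = nmul m (T u)" for u
      using nmul_hom[of T] Sp_groupD(2,4)[OF T] by blast
    have "norm (l T u) = 1" for u
      by (simp add: l_def norm_mult norm_power norm_divide norm_plane_phase[OF T])
    moreover have "l T u * l T v * weyl_cocycle (T u) (T v) = weyl_cocycle u v * l T (u + v)" for u v
    proof -
      let ?r = "\<lambda>u. (weyl_cocycle (T u) (T u) / weyl_cocycle u u) ^ e"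
      \<comment> \<open>Expanding the cocycle at \<open>u + v\<close> gives cross terms in both
        orders. Since \<open>T\<close> is symplectic, the two cross ratios are equal, so their
        product is a square.\<close>
      have odd_part: "?r u * ?r v * weyl_cocycle (T u) (T v) ^ (2 * e) = weyl_cocycle u v ^ (2 * e) * ?r (u + v)"
      proof -
        have "weyl_cocycle (T u) (T v) / weyl_cocycle (T v) (T u) = weyl_cocycle u v / weyl_cocycle v u"
          using Sp_groupD(3)[OF T, of u v] by (simp only: symp_form_cocycle)
        then have *: "weyl_cocycle (T u) (T v) * weyl_cocycle v u = weyl_cocycle u v * weyl_cocycle (T v) (T u)"
          by (simp add: field_simps)
        let ?a = "weyl_cocycle (T u) (T u)" and ?b = "weyl_cocycle (T v) (T v)"
          and ?c = "weyl_cocycle (T u) (T v)" and ?d = "weyl_cocycle (T v) (T u)"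
          and ?a' = "weyl_cocycle u u" and ?b' = "weyl_cocycle v v"
          and ?c' = "weyl_cocycle u v" and ?d' = "weyl_cocycle v u"
        have "?a / ?a' * (?b / ?b') * (?c * ?c) = ?c' * ?c' * (?a * ?c * ?d * ?b / (?a' * ?c' * ?d' * ?b'))"
        proof -
          have "?c' * ?c' * (?a * ?c * ?d * ?b / (?a' * ?c' * ?d' * ?b'))
              = (?c' * ?d) * (?a * ?c * ?b / (?a' * ?d' * ?b'))" by (simp add: mult_ac)
          also have "\<dots> = ?a / ?a' * (?b / ?b') * (?c * ?c)" unfolding *[symmetric] by (simp add: mult_ac)
          finally show ?thesis by simp
        qed
        then show ?thesis
          unfolding Sp_groupD(2)[OF T] cocycle_sum_self
          by (simp only: power_mult power_mult_distrib[symmetric] power2_eq_square)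
      qed
      have "l T u * l T v * weyl_cocycle (T u) (T v)
          = (?r u * ?r v * weyl_cocycle (T u) (T v) ^ (2 * e))
            * (plane_phase T (nmul m u) * plane_phase T (nmul m v) * weyl_cocycle (T (nmul m u)) (T (nmul m v)))"
        by (subst split[of "T u" "T v"]) (simp only: l_def Tm mult_ac)
      also have "\<dots> = (weyl_cocycle u v ^ (2 * e) * weyl_cocycle (nmul m u) (nmul m v)) * l T (u + v)"
        unfolding odd_part plane_phase_cocycle[OF T nm nm] by (simp only: l_def nmul_add mult_ac)
      finally show ?thesis by (simp only: split[symmetric])
    qed
    ultimately show "clifford_phase T (l T)" by (simp add: clifford_phase_def)
    fix S :: "'a phase_space \<Rightarrow> 'a phase_space" and u assume S: "S \<in> carrier Sp_group"
    show "l (S \<circ> T) u = l S (T u) * l T u"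
      by (simp add: l_def plane_phase_comp[OF S T] Tm power_divide)
  qed
  then show ?thesis by blast
qed

end

text \<open>For odd order the plane is zero. For order 2m with \<open>m\<close> odd, it is spanned
  by the involution of the group and the character of order two.\<close>

lemma phase_lift_exists:
  assumes "\<not> 4 dvd CARD('a::{ab_group_add,finite})"
  shows "\<exists>l. phase_lift (l :: ('a phase_space \<Rightarrow> 'a phase_space) \<Rightarrow> _)"
proof (cases "odd (CARD('a))")
  case True
  have ann: "nmul (CARD('a)) u = 0" for u :: "'a phase_space"
    by (intro prod_eqI dual_eqI) (simp_all add: fst_nmul snd_nmul nmul_card_group dual_nmul_apply dual_apply_pow_card)
  interpret involution_plane "0 :: 'a phase_space" 0
  proof
    fix q :: "'a phase_space" assume "q + q = 0"
    then have "nmul 2 q = 0" by (simp add: nmul_two)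
    obtain k where "CARD('a) = 2 * k + 1" using True oddE by blast
    then have "nmul (k * 2 + 1) q = 0" using ann[of q] by (simp add: mult.commute)
    moreover have "nmul (k * 2 + 1) q = nmul k (nmul 2 q) + nmul 1 q"
      by (simp only: nmul_plus nmul_nmul)
    ultimately have "q = 0" using \<open>nmul 2 q = 0\<close> by simp
    then show "q \<in> {0, 0, 0, 0 + 0}" by simp
  qed auto
  show ?thesis by (rule phases_exist[OF True]) (simp add: nmul_nmul[symmetric] ann)
next
  case False
  then obtain m where m: "CARD('a) = 2 * m" by auto
  have "odd m" using assms m by auto
  have ann: "nmul (2 * m) u = 0" for u :: "'a phase_space"
    unfolding m[symmetric]
    by (intro prod_eqI dual_eqI) (simp_all add: fst_nmul snd_nmul nmul_card_group dual_nmul_apply dual_apply_pow_card)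
  have UNIV: "add_subgroup (UNIV :: 'a set)" by (simp add: add_subgroup_def)
  have "even (CARD('a))" using m by simp
  then obtain h :: 'a where h: "h \<noteq> 0" "h + h = 0" using even_card_subgroup_iff[OF UNIV] by blast
  obtain c where "dual_apply c h \<noteq> dual_apply c 0" using dual_separates_points[OF h(1)] by blast
  then have ch: "dual_apply c h = -1" using dual_apply_involution[OF h(2), of c] by auto
  \<comment> \<open>Multiplying by \<open>m\<close> makes the double vanish and, as \<open>m\<close>
    is odd, keeps the value -1 at \<open>h\<close>.\<close>
  define d where "d = nmul m c"
  have d2: "d + d = 0"
    using arg_cong[OF ann[of "(0, c)"], of snd] by (simp add: d_def snd_nmul mult_2 nmul_plus)
  have dh: "dual_apply d h = -1" using ch \<open>odd m\<close> by (simp add: d_def dual_nmul_apply)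
  have dpm: "dual_apply f a = 1 \<or> dual_apply f a = -1" if "f + f = 0" for f and a :: 'a
    using dual_apply_plus[of f f a] that by (simp add: power2_eq_1_iff[symmetric] power2_eq_square)
  \<comment> \<open>The kernel of \<open>d\<close> has index 2, so its order \<open>m\<close> is odd
    and it contains no involution. If g + g = 0, then \<open>g\<close> or \<open>g + h\<close> lies
    in it and is therefore 0.\<close>
  define K where "K = {a. dual_apply d a = 1}"
  have K: "add_subgroup K"
    using dual_apply_uminus[of d] unfolding add_subgroup_def K_def
    by (auto simp: dual_apply_add diff_conv_add_uminus simp del: add_uminus_conv_diff)
  have "CARD('a) = card K * card (range (dual_apply d))"
  proof (rule card_hom_image)
    fix a b :: 'a
    have "dual_apply d a = dual_apply d (a - b) * dual_apply d b"
      by (simp add: dual_apply_add[symmetric])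
    then show "dual_apply d a = dual_apply d b \<longleftrightarrow> a - b \<in> K" by (simp add: K_def)
  qed
  moreover have "range (dual_apply d) = {1, -1}"
  proof (intro equalityI subsetI)
    fix z assume "z \<in> {1, -1 :: complex}"
    then show "z \<in> range (dual_apply d)" using dh dual_apply_0[of d] by (metis insertE rangeI singletonD)
  qed (use dpm[OF d2] in auto)
  ultimately have "card K = m" using m by simp
  then have K1: "g = 0" if "g + g = 0" "dual_apply d g = 1" for g
    using even_card_subgroup_iff[OF K] \<open>odd m\<close> that by (auto simp: K_def)
  have inv: "g = 0 \<or> g = h" if g: "g + g = 0" for g
  proof (cases "dual_apply d g = 1")
    case True then show ?thesis using K1 g by blast
  next
    case False
    then have "dual_apply d (g + h) = 1" using dpm[OF d2, of g] dh by (simp add: dual_apply_add)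
    moreover have "g + h + (g + h) = 0" using g h(2) by (metis add.left_commute add.assoc add_0_right)
    ultimately have "g + h = 0" using K1 by blast
    then show ?thesis using h(2) by (metis add_right_cancel)
  qed
  \<comment> \<open>Such a character depends only on \<open>nmul m a\<close>, which is 0 or
    \<open>h\<close>; its value at \<open>h\<close> therefore determines it.\<close>
  have pow: "dual_apply f a = dual_apply f (nmul m a)" if "f + f = 0" for f and a :: 'a
    using dpm[OF that, of a] \<open>odd m\<close> by (auto simp: dual_apply_nmul)
  have m2: "nmul m a = 0 \<or> nmul m a = h" for a
    using inv arg_cong[OF ann[of "(a, 0)"], of fst] by (simp add: fst_nmul mult_2 nmul_plus)
  have dual_inv: "f = 0 \<or> f = d" if f: "f + f = 0" for f :: "'a dual"
  proof (cases "dual_apply f h = 1")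
    case True
    then have "f = 0" using pow[OF f] m2 by (intro dual_eqI) (metis dual_apply_0 dual_apply_zero)
    then show ?thesis by blast
  next
    case False
    then have "dual_apply f h = dual_apply d h" using dpm[OF f, of h] dh by simp
    then have "f = d" using pow[OF f] pow[OF d2] m2 by (intro dual_eqI) (metis dual_apply_0)
    then show ?thesis by blast
  qed
  interpret involution_plane "(h, 0)" "(0, d)"
  proof
    fix q :: "'a phase_space" assume "q + q = 0"
    then have "fst q + fst q = 0" "snd q + snd q = 0" by (simp_all add: prod_eq_iff)
    then show "q \<in> {0, (h, 0), (0, d), (h, 0) + (0, d)}"
      using inv[of "fst q"] dual_inv[of "snd q"] by (auto simp: prod_eq_iff)
  qed (auto simp: h d2 dh symp_form_def zero_prod_def)
  show ?thesis by (rule phases_exist[OF \<open>odd m\<close> ann])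
qed

theorem theorem1p1:
  shows "(\<exists>\<sigma> \<in> hom (Sp_group :: ('a::{ab_group_add,finite} phase_space \<Rightarrow> 'a phase_space) monoid)
                    clifford_group.
            \<forall>T \<in> carrier Sp_group. clifford_proj (\<sigma> T) = T)
         \<longleftrightarrow> \<not> 4 dvd CARD('a)"
  unfolding splitting_iff_phases
proof
  assume "\<exists>l. (\<forall>T \<in> carrier (Sp_group :: ('a phase_space \<Rightarrow> 'a phase_space) monoid). clifford_phase T (l T)) \<and>
      (\<forall>S \<in> carrier Sp_group. \<forall>T \<in> carrier Sp_group. \<forall>u. l (S \<circ> T) u = l S (T u) * l T u)"
  then obtain l :: "('a phase_space \<Rightarrow> 'a phase_space) \<Rightarrow> 'a phase_space \<Rightarrow> complex"
    where "phase_lift l" unfolding phase_lift_def by blast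
  then show "\<not> 4 dvd CARD('a)" by (rule phase_lift.not_4_dvd_card)
next
  assume "\<not> 4 dvd CARD('a)"
  from phase_lift_exists[OF this]
  show "\<exists>l. (\<forall>T \<in> carrier (Sp_group :: ('a phase_space \<Rightarrow> 'a phase_space) monoid). clifford_phase T (l T)) \<and>
      (\<forall>S \<in> carrier Sp_group. \<forall>T \<in> carrier Sp_group. \<forall>u. l (S \<circ> T) u = l S (T u) * l T u)"
    unfolding phase_lift_def by blast
qed

end
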